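(* Let $(Y_i)_{1\le i\le n}$ be a sequence of non-negative random variables and let $C\ge 0$ be such that, for every $1\le i\le n$, $$\mathbb{E}\Big[\max_{i\le j\le n}(Y_j-Y_i)\,\Big|\,\mathcal{F}_i\Big]\le C\cdot\mathbb{E}[M],$$ where $M=\max_{1\le j\le n}Y_j$ and $\mathcal{F}_i$ is the $\sigma$-algebra generated by $Y_1,\dots,Y_i$. Then, given access to $K$ independent samples from the distribution of $M$, there exists a stopping rule $\tau$ such that $$\mathbb{E}\big[Y_\tau\mathbf 1\{\tau\le n\}\big]\ \ge\ \beta_C(K)\,\mathbb{E}[M],$$ with $\beta_C(K)=\sup\{x-Cx^2: x\in A_K\}$ and $A_K=\{a/b: a,b\in\mathbb{N}\text{ and }0<a<b\le K+1\}$.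
   Context: Here $n,K\in\mathbb{N}$, and the sequence $(Y_i)$ may be dependent. The samples $M_1,\dots,M_K$ are i.i.d. with the distribution of $M$ and independent of $(Y_i)_{1\le i\le n}$. A (possibly randomised) stopping rule with access to the samples decides, at each time $i\le n$ at which it has not yet stopped, whether to stop, based only on $M_1,\dots,M_K$, the observed values $Y_1,\dots,Y_i$, and independent auxiliary randomness; the law of $(Y_i)$ is not otherwise known to it. The same symbol $\tau$ denotes the induced stopping time, with values in $\{1,\dots,n\}\cup\{\infty\}$, where $\tau=\infty$ means that the rule never stops. *)

theory Defs
  imports "HOL-Probability.Probability"
begin

definition run_max :: "nat \<Rightarrow> (nat \<Rightarrow> 'a \<Rightarrow> real) \<Rightarrow> 'a \<Rightarrow> real" where
  "run_max n Y \<omega> = (MAX j\<in>{1..n}. Y j \<omega>)"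

definition gen_sigma :: "'a measure \<Rightarrow> nat \<Rightarrow> (nat \<Rightarrow> 'a \<Rightarrow> real) \<Rightarrow> 'a measure" where
  "gen_sigma P i Y =
     sigma (space P) (\<Union>j\<in>{1..i}. {Y j -` A \<inter> space P | A. A \<in> sets borel})"

(* "d i s y u" is the decision to stop at time i, given the samples s_1..s_K, the observations
   y_1..y_i and the random seed u.  A single uniform seed on [0,1] suffices to generate any
   real-valued (or standard Borel) auxiliary randomness.  The rule is a function of these data
   only, so it cannot depend on the law of the sequence. *)
type_synonym decision = "nat \<Rightarrow> (nat \<Rightarrow> real) \<Rightarrow> (nat \<Rightarrow> real) \<Rightarrow> real \<Rightarrow> bool"

definition stopping_rule :: "nat \<Rightarrow> nat \<Rightarrow> decision \<Rightarrow> bool" where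
  "stopping_rule n K d \<longleftrightarrow>
     (\<forall>i\<in>{1..n}. Measurable.pred
        (PiM {1..K} (\<lambda>_. borel) \<Otimes>\<^sub>M PiM {1..i} (\<lambda>_. borel) \<Otimes>\<^sub>M borel)
        (\<lambda>(s, y, u). d i s y u))"

(* The restrictions hide the future: at time i the rule receives only the values at 1..i. *)
definition stops_at ::
  "nat \<Rightarrow> decision \<Rightarrow> (nat \<Rightarrow> 'a \<Rightarrow> real) \<Rightarrow> (nat \<Rightarrow> 'a \<Rightarrow> real) \<Rightarrow> ('a \<Rightarrow> real) \<Rightarrow> nat \<Rightarrow> 'a \<Rightarrow> bool" where
  "stops_at K d S Y U i \<omega> \<longleftrightarrow> d i (\<lambda>k\<in>{1..K}. S k \<omega>) (\<lambda>j\<in>{1..i}. Y j \<omega>) (U \<omega>)"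

definition induced_time ::
  "nat \<Rightarrow> nat \<Rightarrow> decision \<Rightarrow> (nat \<Rightarrow> 'a \<Rightarrow> real) \<Rightarrow> (nat \<Rightarrow> 'a \<Rightarrow> real) \<Rightarrow> ('a \<Rightarrow> real) \<Rightarrow> 'a \<Rightarrow> enat" where
  "induced_time n K d S Y U \<omega> =
     (if \<exists>i\<in>{1..n}. stops_at K d S Y U i \<omega>
      then enat (LEAST i. i \<in> {1..n} \<and> stops_at K d S Y U i \<omega>) else \<infinity>)"

(* S_1..S_K are i.i.d. copies of the maximum and U is a uniform seed.  The seed is put at index 0
   of the family S, so that the third conjunct says that U, S_1, ..., S_K are mutually independent
   and the last one that (U, S_1, ..., S_K) is independent of (Y_1, ..., Y_n). *)
definition sample_access ::
  "'a measure \<Rightarrow> nat \<Rightarrow> nat \<Rightarrow> (nat \<Rightarrow> 'a \<Rightarrow> real) \<Rightarrow> (nat \<Rightarrow> 'a \<Rightarrow> real) \<Rightarrow> ('a \<Rightarrow> real) \<Rightarrow> bool" where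
  "sample_access P n K Y S U \<longleftrightarrow>
     (\<forall>k\<in>{1..K}. distr P borel (S k) = distr P borel (run_max n Y)) \<and>
     distr P borel U = uniform_measure lborel {0..1} \<and>
     prob_space.indep_vars P (\<lambda>_. borel) (S(0 := U)) {0..K} \<and>
     prob_space.indep_var P
       (PiM {1..n} (\<lambda>_. borel)) (\<lambda>\<omega>. \<lambda>i\<in>{1..n}. Y i \<omega>)
       (PiM {0..K} (\<lambda>_. borel)) (\<lambda>\<omega>. \<lambda>k\<in>{0..K}. (S(0 := U)) k \<omega>)"

definition frac_set :: "nat \<Rightarrow> real set" where
  "frac_set K = {real a / real b | a b :: nat. 0 < a \<and> a < b \<and> b \<le> K + 1}"

(* Meaningful for K >= 1 only: frac_set 0 is empty. *)
definition beta_const :: "real \<Rightarrow> nat \<Rightarrow> real" where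
  "beta_const C K = (SUP x\<in>frac_set K. x - C * x\<^sup>2)"

end

theory Submission
  imports Defs
begin

text \<open>
  Write $x = a/b$ for a fraction at which the supremum defining $\beta_C(K)$ is attained; the supremum
  runs over a finite set. As $b - 1 \<le> K$, the rule can afford $b - 1$ samples, and with them it
  imitates the threshold that the maximum $M$ exceeds with probability exactly $x$: it accepts a value
  if that value would be among the $a$ largest of $b$ numbers, namely itself and the $b - 1$ samples,
  and it stops at the first accepted observation. Acceptance is monotone in the value, so the rule
  stops at some time if and only if $M$ itself is accepted.

  Ties would spoil the exact probability $x$. They are broken by position: the seed picks
  a uniform slot $r < b$ (lemma \<open>prob_slot\<close>), the candidate is inserted there among the samples, and of
  two equal numbers the earlier one ranks first. In the list $z$ of $b$ numbers obtained by inserting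
  $M$ the slot $r$ is then uniform and independent of $z$, and exactly $a$ slots are on top
  (\<open>card_top_set\<close>).

  Let $Y_\tau$ be the reward, $c = C \cdot \mathbb{E}[M]$, and let $A$ be the set of top slots of $z$.
  Two lower bounds on the reward are combined. The first is poor when $M$ is nearly constant and $C$ is
  large, the second when a few large values carry most of $\mathbb{E}[M]$.

  \<^item> Once the samples and the seed are fixed, stopping forfeits in expectation at most $c$ per unit of
    stopping probability, by the hypothesis on conditional expectations
    (\<open>stopped_value_ge_Max\<close>). So the reward is at least $\mathbb{E}[(M - c) 1\{r \<in> A\}]$.
  \<^item> An accepted value is at least as large as every number outside of $A$ (\<open>top_set_dominates\<close>). So
    on the event $r \<in> A$ the reward is at least the average of the $b - a$ numbers $z_k$, $k \<notin> A$.

  Their convex combination with weights $x$ and $1 - x$ is the expectation of the function \<open>score\<close> below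
  (\<open>stopped_value_ge_score\<close>). Its average over $r$ collects the top numbers from the first bound and
  all others from the second, both with weight $x$, and so equals
  $x \cdot \frac1b \sum_k z_k - x^2 c$ (\<open>sum_score\<close>). All $z_k$ have the law of $M$, so the expectation
  of this is $(x - C x^2)\, \mathbb{E}[M]$.
\<close>


section \<open>Ranks with ties broken by position\<close>

text \<open>The order is the lexicographic one, larger value first and then smaller index. It is strict and
  total, which makes the number of predecessors a permutation of the indices whatever ties occur.\<close>
definition desc_rank :: "nat \<Rightarrow> (nat \<Rightarrow> real) \<Rightarrow> nat \<Rightarrow> nat" where
  "desc_rank b z k = card {j \<in> {..<b}. z k < z j \<or> (z j = z k \<and> j < k)}"

definition top_set :: "nat \<Rightarrow> nat \<Rightarrow> (nat \<Rightarrow> real) \<Rightarrow> nat set" where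
  "top_set a b z = {k \<in> {..<b}. desc_rank b z k < a}"

text \<open>The sets of predecessors form a strict chain, so their cardinalities are distinct numbers below $b$.\<close>
lemma desc_rank_bij: "bij_betw (desc_rank b z) {..<b} {..<b}"
proof -
  define B where "B k = {j \<in> {..<b}. z k < z j \<or> (z j = z k \<and> j < k)}" for k
  have fin: "finite (B k)" for k unfolding B_def by simp
  have lt: "card (B j) < card (B k)" if "j \<in> B k" for j k
  proof (rule psubset_card_mono[OF fin])
    have "B j \<subseteq> B k" using that unfolding B_def by auto
    moreover have "j \<notin> B j" unfolding B_def by simp
    ultimately show "B j \<subset> B k" using that by blast
  qed
  have tot: "j \<in> B k \<or> k \<in> B j" if "j < b" "k < b" "j \<noteq> k" for j k
    using that unfolding B_def by auto
  have inj: "inj_on (desc_rank b z) {..<b}"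
  proof (rule inj_onI)
    fix j k assume "j \<in> {..<b}" "k \<in> {..<b}" and "desc_rank b z j = desc_rank b z k"
    then show "j = k" using tot[of j k] lt[of j k] lt[of k j]
      unfolding desc_rank_def B_def[symmetric] by auto
  qed
  have sub: "desc_rank b z ` {..<b} \<subseteq> {..<b}"
  proof
    fix m assume "m \<in> desc_rank b z ` {..<b}"
    then obtain k where k: "k < b" "m = card (B k)" unfolding desc_rank_def B_def by auto
    have "B k \<subset> {..<b}" using k(1) unfolding B_def by auto
    then have "card (B k) < card {..<b}" by (intro psubset_card_mono) auto
    then show "m \<in> {..<b}" using k by simp
  qed
  have "desc_rank b z ` {..<b} = {..<b}"
    by (rule endo_inj_surj[OF _ sub inj]) simp
  then show ?thesis using inj by (simp add: bij_betw_def)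
qed

lemma top_set_subset: "top_set a b z \<subseteq> {..<b}"
  by (auto simp: top_set_def)

lemma card_top_set:
  assumes "a \<le> b"
  shows "card (top_set a b z) = a"
proof -
  have "desc_rank b z ` top_set a b z = {..<a}"
  proof -
    have im: "desc_rank b z ` {..<b} = {..<b}" using desc_rank_bij[of b z] by (simp add: bij_betw_def)
    show ?thesis
    proof
      show "desc_rank b z ` top_set a b z \<subseteq> {..<a}" by (auto simp: top_set_def)
      show "{..<a} \<subseteq> desc_rank b z ` top_set a b z"
      proof
        fix m assume m: "m \<in> {..<a}"
        then have "m \<in> desc_rank b z ` {..<b}" using im assms by simp
        then show "m \<in> desc_rank b z ` top_set a b z" using m by (auto simp: top_set_def)
      qed
    qed
  qed
  moreover have "inj_on (desc_rank b z) (top_set a b z)"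
    using desc_rank_bij[of b z] by (auto simp: bij_betw_def top_set_def intro: inj_on_subset)
  ultimately show ?thesis using card_image by fastforce
qed

text \<open>Raising the entry at $r$ can only shrink its set of predecessors. This makes acceptance an upward
  closed condition on the candidate value, so that the maximum is accepted as soon as any value is.\<close>
lemma top_set_upward:
  assumes "r \<in> top_set a b (z(r := y))" and "y \<le> y'"
  shows "r \<in> top_set a b (z(r := y'))"
proof -
  have "desc_rank b (z(r := y')) r \<le> desc_rank b (z(r := y)) r"
    unfolding desc_rank_def using assms(2) by (intro card_mono) auto
  then show ?thesis using assms(1) by (auto simp: top_set_def)
qed

text \<open>The accepted observation $y$ may be smaller than the maximum $m$ that determines the top set. The
  bound survives because lowering $r$ from $m$ to $y < z_k$ would leave behind $k$ everything that beats
  $k$ except possibly $r$, and put $k$ itself in front of $r$; that is too many predecessors for $r$ to be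
  accepted.\<close>
lemma top_set_dominates:
  assumes acc: "r \<in> top_set a b (z(r := y))" and "y \<le> m"
    and k: "k < b" "k \<notin> top_set a b (z(r := m))"
  shows "z k \<le> y"
proof (rule ccontr)
  assume "\<not> z k \<le> y"
  have "r \<in> top_set a b (z(r := m))" using top_set_upward[OF acc \<open>y \<le> m\<close>] .
  then have kr: "k \<noteq> r" using k by auto
  let ?B = "{j \<in> {..<b}. (z(r := m)) k < (z(r := m)) j \<or> ((z(r := m)) j = (z(r := m)) k \<and> j < k)}"
  let ?R = "{j \<in> {..<b}. (z(r := y)) r < (z(r := y)) j \<or> ((z(r := y)) j = (z(r := y)) r \<and> j < r)}"
  have "insert k (?B - {r}) \<subseteq> ?R"
    using \<open>\<not> z k \<le> y\<close> kr k(1) by (auto split: if_splits)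
  then have "card (insert k (?B - {r})) \<le> card ?R" by (intro card_mono) auto
  moreover have "card (insert k (?B - {r})) = Suc (card (?B - {r}))"
    by (rule card_insert_disjoint) auto
  moreover have "card X \<le> Suc (card (X - {r}))" if "finite X" for X
    using that by (cases "r \<in> X") (simp_all add: card_Suc_Diff1)
  then have "card ?B \<le> Suc (card (?B - {r}))" by simp
  moreover have "a \<le> card ?B" using k by (simp add: top_set_def desc_rank_def)
  moreover have "card ?R < a" using acc unfolding top_set_def desc_rank_def by blast
  ultimately show False by linarith
qed

lemma top_set_cong:
  assumes "\<And>k. k < b \<Longrightarrow> z k = z' k"
  shows "top_set a b z = top_set a b z'"
proof -
  have "desc_rank b z k = desc_rank b z' k" if "k < b" for k
    unfolding desc_rank_def using assms that by (intro arg_cong[where f = card]) auto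
  then show ?thesis unfolding top_set_def by auto
qed

lemma measurable_top_set:
  assumes z: "\<And>k. k < b \<Longrightarrow> (\<lambda>x. z x k) \<in> borel_measurable M"
  shows "Measurable.pred M (\<lambda>x. r \<in> top_set a b (z x))"
proof (cases "r < b")
  case True
  have 1: "{x \<in> space M. j \<in> {j \<in> {..<b}. z x r < z x j \<or> (z x j = z x r \<and> j < r)}} \<in> sets M" for j
  proof (cases "j < b")
    case True
    have [measurable]: "(\<lambda>x. z x j) \<in> borel_measurable M" "(\<lambda>x. z x r) \<in> borel_measurable M"
      using z True \<open>r < b\<close> by auto
    show ?thesis using True by simp
  qed simp
  have "(\<lambda>x. desc_rank b (z x) r) \<in> measurable M (count_space UNIV)"
    unfolding desc_rank_def using 1 by (rule measurable_card)
  then have "Measurable.pred M (\<lambda>x. desc_rank b (z x) r < a)" by measurable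
  then show ?thesis using True unfolding top_set_def by simp
qed (simp add: top_set_def)


section \<open>Acceptance by rank at a random slot\<close>

text \<open>The argument \<open>s\<close> is indexed from 1, as the samples are. Slots before \<open>r\<close> hold
  $s_1, \dots, s_r$ and slots after it $s_{r+1}, s_{r+2}, \dots$\<close>
definition insert_at :: "nat \<Rightarrow> (nat \<Rightarrow> real) \<Rightarrow> real \<Rightarrow> nat \<Rightarrow> real" where
  "insert_at r s y = (\<lambda>k. if k < r then s (Suc k) else s k)(r := y)"

text \<open>For $u \<in> [0,1)$ this says $r = \lfloor b u \rfloor$; for all other $u$ no slot exists, and nothing is ever
  accepted.\<close>
definition slot :: "nat \<Rightarrow> real \<Rightarrow> nat \<Rightarrow> bool" where
  "slot b u r \<longleftrightarrow> r < b \<and> real r \<le> real b * u \<and> real b * u < real r + 1"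

definition accepts :: "nat \<Rightarrow> nat \<Rightarrow> (nat \<Rightarrow> real) \<Rightarrow> real \<Rightarrow> real \<Rightarrow> bool" where
  "accepts a b s u y \<longleftrightarrow> (\<exists>r<b. slot b u r \<and> r \<in> top_set a b (insert_at r s y))"

lemma accepts_slot:
  assumes "slot b u r"
  shows "accepts a b s u y \<longleftrightarrow> r \<in> top_set a b (insert_at r s y)"
proof -
  have "r' = r" if "slot b u r'" for r' using that assms unfolding slot_def by linarith
  then show ?thesis using assms unfolding accepts_def slot_def by blast
qed

lemma sum_slot:
  assumes "slot b u r"
  shows "(\<Sum>r<b. if slot b u r then f r else 0) = (f r :: real)"
proof -
  have iff: "slot b u r' \<longleftrightarrow> r' = r" for r' using assms unfolding slot_def by auto
  have "r < b" using assms by (simp add: slot_def)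
  then show ?thesis by (simp add: iff)
qed

lemma no_slot:
  assumes "\<And>r. \<not> slot b u r"
  shows "\<not> accepts a b s u y" "(\<Sum>r<b. if slot b u r then f r else 0) = (0 :: real)"
  using assms by (simp_all add: accepts_def)

lemma measurable_insert_at:
  assumes "\<And>j. j \<in> {1..<b} \<Longrightarrow> (\<lambda>x. s x j) \<in> borel_measurable M" "y \<in> borel_measurable M"
    and "r < b" "k < b"
  shows "(\<lambda>x. insert_at r (s x) (y x) k) \<in> borel_measurable M"
  unfolding insert_at_def using assms by (cases "k < r"; cases "k = r") auto

lemma measurable_accepts:
  assumes s: "\<And>j. j \<in> {1..<b} \<Longrightarrow> (\<lambda>x. s x j) \<in> borel_measurable M"
    and y: "y \<in> borel_measurable M" and u: "u \<in> borel_measurable M"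
  shows "Measurable.pred M (\<lambda>x. accepts a b (s x) (u x) (y x))"
proof -
  have "Measurable.pred M (\<lambda>x. \<exists>r\<in>{..<b}. slot b (u x) r \<and> r \<in> top_set a b (insert_at r (s x) (y x)))"
  proof (rule pred_intros_finite)
    fix r assume "r \<in> {..<b}"
    then have 1: "Measurable.pred M (\<lambda>x. r \<in> top_set a b (insert_at r (s x) (y x)))"
      by (intro measurable_top_set measurable_insert_at[where b = b] s y) auto
    have 2: "Measurable.pred M (\<lambda>x. slot b (u x) r)"
      unfolding slot_def using u by measurable
    show "Measurable.pred M (\<lambda>x. slot b (u x) r \<and> r \<in> top_set a b (insert_at r (s x) (y x)))"
      using 2 1 by (rule pred_intros_logic)
  qed simp
  then show ?thesis unfolding accepts_def Bex_def lessThan_iff .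
qed

lemma prob_slot:
  assumes "prob_space P" "U \<in> borel_measurable P"
    and U: "distr P borel U = uniform_measure lborel {0..1::real}" and r: "r < b"
  shows "measure P {\<omega> \<in> space P. slot b (U \<omega>) r} = 1 / real b"
proof -
  let ?I = "{real r / real b..<(real r + 1) / real b}"
  have b: "0 < real b" using r by simp
  have "measure P {\<omega> \<in> space P. slot b (U \<omega>) r} = measure P (U -` ?I \<inter> space P)"
    using r b by (intro arg_cong[where f = "measure P"]) (auto simp: slot_def field_simps)
  also have "\<dots> = measure (uniform_measure lborel {0..1::real}) ?I"
    unfolding U[symmetric] using assms(2) by (subst measure_distr) auto
  also have "\<dots> = measure lborel ({0..1} \<inter> ?I) / measure lborel {0..1::real}"
    by (intro measure_uniform_measure) auto
  also have "{0..1} \<inter> ?I = ?I"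
  proof -
    have "(real r + 1) / real b \<le> 1" using r b by (simp add: field_simps)
    moreover have "0 \<le> real r / real b" by simp
    ultimately have "?I \<subseteq> {0..1}"
      using atLeastLessThan_subseteq_atLeastAtMost_iff[of "real r / real b"] by blast
    then show ?thesis by (rule Int_absorb1)
  qed
  also have "measure lborel ?I = (real r + 1) / real b - real r / real b"
    using b by (intro measure_lborel_Ico divide_right_mono) auto
  also have "\<dots> = 1 / real b" by (simp add: add_divide_distrib)
  finally show ?thesis by simp
qed


section \<open>The first value in an upward closed set\<close>

definition first_hit :: "(real \<Rightarrow> bool) \<Rightarrow> (nat \<Rightarrow> real) \<Rightarrow> nat \<Rightarrow> bool" where
  "first_hit Acc y i \<longleftrightarrow> Acc (y i) \<and> (\<forall>j\<in>{1..<i}. \<not> Acc (y j))"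

text \<open>At most one summand is not zero. The form as a sum over times is the one that conditional
  expectations can be applied to.\<close>
definition stopped_value :: "nat \<Rightarrow> (real \<Rightarrow> bool) \<Rightarrow> (nat \<Rightarrow> real) \<Rightarrow> real" where
  "stopped_value n Acc y = (\<Sum>i\<in>{1..n}. if first_hit Acc y i then y i else 0)"

lemma first_hit_exists:
  assumes "\<exists>i\<in>{1..n}. Acc (y i)"
  obtains i where "i \<in> {1..n}" "first_hit Acc y i"
proof -
  let ?i = "LEAST i. i \<in> {1..n} \<and> Acc (y i)"
  have "?i \<in> {1..n} \<and> Acc (y ?i)" by (rule LeastI_ex) (use assms in blast)
  moreover have "\<not> Acc (y j)" if "j \<in> {1..<?i}" for j
    using not_less_Least[of j "\<lambda>i. i \<in> {1..n} \<and> Acc (y i)"] that calculation by auto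
  ultimately show thesis using that unfolding first_hit_def by blast
qed

lemma first_hit_unique:
  assumes "first_hit Acc y i" "first_hit Acc y j" "1 \<le> i" "1 \<le> j"
  shows "i = j"
proof (rule linorder_cases)
  assume "i < j" then show ?thesis using assms unfolding first_hit_def by auto
next
  assume "j < i" then show ?thesis using assms unfolding first_hit_def by auto
qed

lemma sum_first_hit:
  assumes i: "i \<in> {1..n}" "first_hit Acc y i"
  shows "(\<Sum>j\<in>{1..n}. if first_hit Acc y j then f j else 0) = (f i :: real)"
proof -
  have "(\<Sum>j\<in>{1..n}. if first_hit Acc y j then f j else 0) = (\<Sum>j\<in>{1..n}. if j = i then f j else 0)"
  proof (intro sum.cong refl)
    fix j assume "j \<in> {1..n}"
    then have "first_hit Acc y j \<longleftrightarrow> j = i"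
      using first_hit_unique[of Acc y j i] i by (metis atLeastAtMost_iff)
    then show "(if first_hit Acc y j then f j else 0) = (if j = i then f j else 0)" by simp
  qed
  then show ?thesis using i by simp
qed

lemma stopped_value_hit:
  assumes "i \<in> {1..n}" "first_hit Acc y i"
  shows "stopped_value n Acc y = y i"
  unfolding stopped_value_def by (rule sum_first_hit[OF assms])

lemma stopped_value_no_hit:
  assumes "\<And>i. i \<in> {1..n} \<Longrightarrow> \<not> Acc (y i)"
  shows "stopped_value n Acc y = 0"
  unfolding stopped_value_def using assms by (intro sum.neutral) (auto simp: first_hit_def)

lemma mono_pred_Max_iff:
  fixes y :: "nat \<Rightarrow> real"
  assumes up: "mono Acc" and n: "1 \<le> n"
  shows "Acc (MAX j\<in>{1..n}. y j) \<longleftrightarrow> (\<exists>i\<in>{1..n}. Acc (y i))"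
proof
  assume a: "Acc (MAX j\<in>{1..n}. y j)"
  have "(MAX j\<in>{1..n}. y j) \<in> y ` {1..n}" using n by (intro Max_in) auto
  then show "\<exists>i\<in>{1..n}. Acc (y i)" using a by auto
next
  assume "\<exists>i\<in>{1..n}. Acc (y i)"
  then obtain i where "i \<in> {1..n}" "Acc (y i)" by auto
  then show "Acc (MAX j\<in>{1..n}. y j)" using monoD[OF up, of "y i" "MAX j\<in>{1..n}. y j"] by simp
qed

text \<open>Values before the first hit were rejected, hence lie below the first accepted one; so the maximum is
  attained at the hitting time or later. Thereby the quantity in the hypothesis of the theorem, which
  looks only at the future, measures the loss against the overall maximum.\<close>
lemma Max_minus_first_hit:
  assumes up: "mono Acc" and i: "i \<in> {1..n}" "first_hit Acc y i"
  shows "(MAX j\<in>{1..n}. y j) - y i = (MAX j\<in>{i..n}. y j - y i :: real)"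
proof (rule antisym)
  have "(MAX j\<in>{1..n}. y j) \<le> (MAX j\<in>{i..n}. y j - y i) + y i"
  proof (subst Max_le_iff)
    have tail: "y j - y i \<le> (MAX j\<in>{i..n}. y j - y i)" if "j \<in> {i..n}" for j
      using that by simp
    have "y j \<le> (MAX j\<in>{i..n}. y j - y i) + y i" if j: "j \<in> {1..n}" for j
    proof (cases "i \<le> j")
      case True
      have "y j - y i \<le> (MAX j\<in>{i..n}. y j - y i)" by (rule tail) (use True j in simp)
      then show ?thesis by linarith
    next
      case False
      then have "\<not> Acc (y j)" using i j unfolding first_hit_def by auto
      then have "y j \<le> y i" using monoD[OF up, of "y i" "y j"] i(2) unfolding first_hit_def by (meson linear le_boolD)
      moreover have "y i - y i \<le> (MAX j\<in>{i..n}. y j - y i)" by (rule tail) (use i in simp)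
      ultimately show ?thesis by linarith
    qed
    then show "\<forall>v\<in>y ` {1..n}. v \<le> (MAX j\<in>{i..n}. y j - y i) + y i" by auto
  qed (use i in auto)
  then show "(MAX j\<in>{1..n}. y j) - y i \<le> (MAX j\<in>{i..n}. y j - y i)" by simp
  show "(MAX j\<in>{i..n}. y j - y i) \<le> (MAX j\<in>{1..n}. y j) - y i"
    using i by (subst Max_le_iff) auto
qed

lemma stopped_value_decomp:
  fixes y :: "nat \<Rightarrow> real"
  assumes up: "mono Acc" and n: "1 \<le> n"
  shows "(if Acc (MAX j\<in>{1..n}. y j) then (MAX j\<in>{1..n}. y j) - c else 0) - stopped_value n Acc y
    = (\<Sum>i\<in>{1..n}. if first_hit Acc y i then (MAX j\<in>{i..n}. y j - y i) - c else 0)"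
proof (cases "\<exists>i\<in>{1..n}. Acc (y i)")
  case True
  then obtain i where i: "i \<in> {1..n}" "first_hit Acc y i" by (rule first_hit_exists)
  have "Acc (MAX j\<in>{1..n}. y j)"
    using True mono_pred_Max_iff[OF up n] by blast
  moreover have "(\<Sum>i\<in>{1..n}. if first_hit Acc y i then (MAX j\<in>{i..n}. y j - y i) - c else 0)
      = (MAX j\<in>{1..n}. y j) - y i - c"
    using sum_first_hit[OF i, of "\<lambda>i. (MAX j\<in>{i..n}. y j - y i) - c"]
      Max_minus_first_hit[OF up i] by simp
  moreover have "stopped_value n Acc y = y i" by (rule stopped_value_hit[OF i])
  ultimately show ?thesis by simp
next
  case False
  then have "(\<Sum>i\<in>{1..n}. if first_hit Acc y i then (MAX j\<in>{i..n}. y j - y i) - c else 0) = 0"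
    by (intro sum.neutral) (auto simp: first_hit_def)
  then show ?thesis
    using False mono_pred_Max_iff[OF up n] stopped_value_no_hit[of n Acc y] by auto
qed

lemma stopped_value_bounds:
  assumes "1 \<le> n" "\<And>i. i \<in> {1..n} \<Longrightarrow> 0 \<le> y i"
  shows "0 \<le> stopped_value n Acc y" "stopped_value n Acc y \<le> (MAX j\<in>{1..n}. y j)"
proof -
  have *: "0 \<le> (MAX j\<in>{1..n}. y j)" "\<And>i. i \<in> {1..n} \<Longrightarrow> y i \<le> (MAX j\<in>{1..n}. y j)"
    using assms(2)[of 1] assms(1) by (auto simp: Max_ge_iff)
  have "0 \<le> stopped_value n Acc y \<and> stopped_value n Acc y \<le> (MAX j\<in>{1..n}. y j)"
  proof (cases "\<exists>i\<in>{1..n}. Acc (y i)")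
    case True
    then obtain i where i: "i \<in> {1..n}" "first_hit Acc y i" by (rule first_hit_exists)
    then show ?thesis using assms(2) * stopped_value_hit[OF i] by auto
  next
    case False
    then have "stopped_value n Acc y = 0" by (intro stopped_value_no_hit) auto
    then show ?thesis using * by simp
  qed
  then show "0 \<le> stopped_value n Acc y" "stopped_value n Acc y \<le> (MAX j\<in>{1..n}. y j)" by auto
qed

lemma measurable_first_hit:
  assumes "\<And>j. j \<in> {1..i} \<Longrightarrow> Measurable.pred M (\<lambda>x. A x (y x j))" "1 \<le> i"
  shows "Measurable.pred M (\<lambda>x. first_hit (A x) (y x) i)"
  unfolding first_hit_def using assms
  by (intro pred_intros_logic pred_intros_finite) auto

lemma borel_measurable_stopped_value:
  assumes "\<And>j. j \<in> {1..n} \<Longrightarrow> Measurable.pred M (\<lambda>x. A x (y x j))"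
    and y: "\<And>j. j \<in> {1..n} \<Longrightarrow> (\<lambda>x. y x j) \<in> borel_measurable M"
  shows "(\<lambda>x. stopped_value n (A x) (y x)) \<in> borel_measurable M"
  unfolding stopped_value_def
proof (rule borel_measurable_sum)
  fix i assume i: "i \<in> {1..n}"
  then have [measurable]: "Measurable.pred M (\<lambda>x. first_hit (A x) (y x) i)"
    "(\<lambda>x. y x i) \<in> borel_measurable M"
    using assms by (auto intro!: measurable_first_hit)
  show "(\<lambda>x. if first_hit (A x) (y x) i then y x i else 0) \<in> borel_measurable M" by measurable
qed


section \<open>The expected loss from stopping\<close>

lemma borel_measurable_Max_image:
  fixes f :: "'i \<Rightarrow> 'a \<Rightarrow> real"
  assumes "finite I" "I \<noteq> {}" "\<And>i. i \<in> I \<Longrightarrow> f i \<in> borel_measurable M"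
  shows "(\<lambda>x. MAX i\<in>I. f i x) \<in> borel_measurable M"
  using assms by (intro borel_measurable_Max) auto

lemma space_gen_sigma: "space (gen_sigma P i Y) = space P"
  by (simp add: gen_sigma_def space_measure_of_conv)

text \<open>The generating sets lie in the power set of the space, so \<open>sigma\<close> does not degenerate.\<close>
lemma sets_gen_sigma:
  "sets (gen_sigma P i Y)
    = sigma_sets (space P) (\<Union>j\<in>{1..i}. {Y j -` A \<inter> space P | A. A \<in> sets borel})"
  unfolding gen_sigma_def by (intro sets_measure_of) auto

lemma borel_measurable_gen_sigma:
  assumes "j \<in> {1..i}"
  shows "Y j \<in> borel_measurable (gen_sigma P i Y)"
proof (rule measurableI)
  fix A :: "real set" assume "A \<in> sets borel"
  then show "Y j -` A \<inter> space (gen_sigma P i Y) \<in> sets (gen_sigma P i Y)"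
    unfolding space_gen_sigma sets_gen_sigma using assms by (intro sigma_sets.Basic UN_I[of j]) auto
qed simp

lemma subalgebra_gen_sigma:
  assumes "\<And>j. j \<in> {1..i} \<Longrightarrow> Y j \<in> borel_measurable P"
  shows "subalgebra P (gen_sigma P i Y)"
  unfolding subalgebra_def space_gen_sigma sets_gen_sigma
  using assms by (auto intro!: sets.sigma_sets_subset measurable_sets)

text \<open>The event that the first hit happens at time $i$ belongs to the $\sigma$-algebra of the first $i$
  observations. Integrating the conditional bound over this event shows that stopping there loses
  at most $c$ times its probability, and summing over $i$ gives $c$ times the probability that the
  maximum is accepted.\<close>
lemma stopped_value_ge_Max:
  assumes P: "prob_space P" and n: "1 \<le> n"
    and Y: "\<And>i. i \<in> {1..n} \<Longrightarrow> Y i \<in> borel_measurable P"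
    and nn: "\<And>i \<omega>. i \<in> {1..n} \<Longrightarrow> \<omega> \<in> space P \<Longrightarrow> 0 \<le> Y i \<omega>"
    and int: "integrable P (run_max n Y)"
    and ce: "\<And>i. i \<in> {1..n} \<Longrightarrow> AE \<omega> in P.
      real_cond_exp P (gen_sigma P i Y) (\<lambda>\<omega>. MAX j\<in>{i..n}. Y j \<omega> - Y i \<omega>) \<omega> \<le> c"
    and up: "mono Acc" and Acc: "Measurable.pred borel Acc"
  shows "integrable P (\<lambda>\<omega>. stopped_value n Acc (\<lambda>i. Y i \<omega>))"
    and "integrable P (\<lambda>\<omega>. if Acc (run_max n Y \<omega>) then run_max n Y \<omega> - c else 0)"
    and "(\<integral>\<omega>. (if Acc (run_max n Y \<omega>) then run_max n Y \<omega> - c else 0) \<partial>P)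
      \<le> (\<integral>\<omega>. stopped_value n Acc (\<lambda>i. Y i \<omega>) \<partial>P)"
proof -
  interpret prob_space P by (rule P)
  have AccY: "Measurable.pred P (\<lambda>\<omega>. Acc (Y j \<omega>))" if "j \<in> {1..n}" for j
    using Acc Y[OF that] by measurable
  have [measurable]: "run_max n Y \<in> borel_measurable P" using int by simp
  note Acc[measurable]
  show sv: "integrable P (\<lambda>\<omega>. stopped_value n Acc (\<lambda>i. Y i \<omega>))"
  proof (rule Bochner_Integration.integrable_bound[OF int])
    show "(\<lambda>\<omega>. stopped_value n Acc (\<lambda>i. Y i \<omega>)) \<in> borel_measurable P"
      using AccY Y by (rule borel_measurable_stopped_value)
    show "AE \<omega> in P. norm (stopped_value n Acc (\<lambda>i. Y i \<omega>)) \<le> norm (run_max n Y \<omega>)"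
    proof (rule AE_I2)
      fix \<omega> assume "\<omega> \<in> space P"
      then show "norm (stopped_value n Acc (\<lambda>i. Y i \<omega>)) \<le> norm (run_max n Y \<omega>)"
        using stopped_value_bounds[OF n, of "\<lambda>i. Y i \<omega>" Acc] nn unfolding run_max_def by auto
    qed
  qed
  show lv: "integrable P (\<lambda>\<omega>. if Acc (run_max n Y \<omega>) then run_max n Y \<omega> - c else 0)"
  proof (rule Bochner_Integration.integrable_bound)
    show "integrable P (\<lambda>\<omega>. run_max n Y \<omega> - c)" using int by simp
  qed auto
  let ?G = "\<lambda>i \<omega>. MAX j\<in>{i..n}. Y j \<omega> - Y i \<omega>"
  let ?H = "\<lambda>i. {\<omega> \<in> space P. first_hit Acc (\<lambda>j. Y j \<omega>) i}"
  have G: "integrable P (?G i)" if i: "i \<in> {1..n}" for i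
  proof (rule Bochner_Integration.integrable_bound[OF int])
    show "?G i \<in> borel_measurable P"
      using i Y by (intro borel_measurable_Max_image borel_measurable_diff) auto
    show "AE \<omega> in P. norm (?G i \<omega>) \<le> norm (run_max n Y \<omega>)"
    proof (rule AE_I2)
      fix \<omega> assume w: "\<omega> \<in> space P"
      have ub: "Y j \<omega> \<le> run_max n Y \<omega>" if "j \<in> {1..n}" for j
        unfolding run_max_def using that by simp
      have "Y i \<omega> - Y i \<omega> \<le> ?G i \<omega>" using i by (intro Max_ge) auto
      moreover have "?G i \<omega> \<le> run_max n Y \<omega>"
      proof (subst Max_le_iff)
        have "Y j \<omega> - Y i \<omega> \<le> run_max n Y \<omega>" if "j \<in> {i..n}" for j
          using ub[of j] nn[OF i w] that i by auto
        then show "\<forall>v\<in>(\<lambda>j. Y j \<omega> - Y i \<omega>) ` {i..n}. v \<le> run_max n Y \<omega>" by auto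
      qed (use i in auto)
      ultimately show "norm (?G i \<omega>) \<le> norm (run_max n Y \<omega>)" by simp
    qed
  qed
  have H: "?H i \<in> sets (gen_sigma P i Y)" "?H i \<in> sets P" if i: "i \<in> {1..n}" for i
  proof -
    have "Measurable.pred (gen_sigma P i Y) (\<lambda>\<omega>. first_hit Acc (\<lambda>j. Y j \<omega>) i)"
    proof (rule measurable_first_hit)
      fix j assume "j \<in> {1..i}"
      then have "Y j \<in> borel_measurable (gen_sigma P i Y)" by (rule borel_measurable_gen_sigma)
      then show "Measurable.pred (gen_sigma P i Y) (\<lambda>\<omega>. Acc (Y j \<omega>))" using Acc by measurable
    qed (use i in auto)
    then show 1: "?H i \<in> sets (gen_sigma P i Y)"
      unfolding pred_def space_gen_sigma .
    have "subalgebra P (gen_sigma P i Y)"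
      using Y i by (intro subalgebra_gen_sigma) auto
    then show "?H i \<in> sets P" using 1 unfolding subalgebra_def by auto
  qed
  have part: "integrable P (\<lambda>\<omega>. if first_hit Acc (\<lambda>j. Y j \<omega>) i then ?G i \<omega> - c else 0)
      \<and> (\<integral>\<omega>. (if first_hit Acc (\<lambda>j. Y j \<omega>) i then ?G i \<omega> - c else 0) \<partial>P) \<le> 0"
    if i: "i \<in> {1..n}" for i
  proof -
    have sub: "subalgebra P (gen_sigma P i Y)"
      using Y i by (intro subalgebra_gen_sigma) auto
    interpret finite_measure_subalgebra P "gen_sigma P i Y"
      by standard (rule sub)
    let ?R = "real_cond_exp P (gen_sigma P i Y) (?G i)"
    have iG: "integrable P (\<lambda>\<omega>. indicator (?H i) \<omega> * ?G i \<omega>)"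
      using integrable_mult_indicator[OF H(2)[OF i] G[OF i]] by simp
    have iR: "integrable P (\<lambda>\<omega>. indicator (?H i) \<omega> * ?R \<omega>)"
      using integrable_mult_indicator[OF H(2)[OF i] real_cond_exp_int(1)[OF G[OF i]]] by simp
    have ic: "integrable P (\<lambda>\<omega>. indicator (?H i) \<omega> * c)"
      using H(2)[OF i] by (intro integrable_mult_left integrable_real_indicator) (auto simp: emeasure_eq_measure)
    have eq: "(if first_hit Acc (\<lambda>j. Y j \<omega>) i then ?G i \<omega> - c else 0)
      = indicator (?H i) \<omega> * ?G i \<omega> - indicator (?H i) \<omega> * c" if "\<omega> \<in> space P" for \<omega>
      using that by (auto simp: indicator_def)
    have "(\<integral>\<omega>. indicator (?H i) \<omega> * ?G i \<omega> \<partial>P) = (\<integral>\<omega>. indicator (?H i) \<omega> * ?R \<omega> \<partial>P)"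
      using real_cond_exp_intA[OF G[OF i] H(1)[OF i]]
      unfolding set_lebesgue_integral_def by simp
    also have "\<dots> \<le> (\<integral>\<omega>. indicator (?H i) \<omega> * c \<partial>P)"
      using ce[OF i] by (intro integral_mono_AE iR ic) (auto elim!: eventually_mono simp: indicator_def)
    finally have "(\<integral>\<omega>. indicator (?H i) \<omega> * ?G i \<omega> - indicator (?H i) \<omega> * c \<partial>P) \<le> 0"
      by (subst Bochner_Integration.integral_diff[OF iG ic]) simp
    then have "(\<integral>\<omega>. (if first_hit Acc (\<lambda>j. Y j \<omega>) i then ?G i \<omega> - c else 0) \<partial>P) \<le> 0"
      by (subst Bochner_Integration.integral_cong[OF refl eq])
    moreover have "integrable P (\<lambda>\<omega>. if first_hit Acc (\<lambda>j. Y j \<omega>) i then ?G i \<omega> - c else 0)"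
      by (rule iffD2[OF Bochner_Integration.integrable_cong[OF refl eq]
            Bochner_Integration.integrable_diff[OF iG ic]])
    ultimately show ?thesis by blast
  qed
  have "(\<integral>\<omega>. (if Acc (run_max n Y \<omega>) then run_max n Y \<omega> - c else 0) \<partial>P)
      - (\<integral>\<omega>. stopped_value n Acc (\<lambda>i. Y i \<omega>) \<partial>P)
    = (\<integral>\<omega>. (if Acc (run_max n Y \<omega>) then run_max n Y \<omega> - c else 0)
        - stopped_value n Acc (\<lambda>i. Y i \<omega>) \<partial>P)"
    using Bochner_Integration.integral_diff[OF lv sv] by simp
  also have "\<dots> = (\<integral>\<omega>. (\<Sum>i\<in>{1..n}. if first_hit Acc (\<lambda>j. Y j \<omega>) i then ?G i \<omega> - c else 0) \<partial>P)"
    unfolding run_max_def using stopped_value_decomp[OF up n] by simp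
  also have "\<dots> = (\<Sum>i\<in>{1..n}. \<integral>\<omega>. (if first_hit Acc (\<lambda>j. Y j \<omega>) i then ?G i \<omega> - c else 0) \<partial>P)"
    using part by (intro Bochner_Integration.integral_sum) auto
  also have "\<dots> \<le> 0" using part by (intro sum_nonpos) auto
  finally show "(\<integral>\<omega>. (if Acc (run_max n Y \<omega>) then run_max n Y \<omega> - c else 0) \<partial>P)
      \<le> (\<integral>\<omega>. stopped_value n Acc (\<lambda>i. Y i \<omega>) \<partial>P)" by simp
qed


section \<open>Combining the two lower bounds\<close>

text \<open>The convex combination, with weights $x = a/b$ and $1 - x$, of the two lower bounds $z_r - c$ and
  $\frac{1}{b-a} \sum_{k \<notin> A} z_k$ for the reward when the maximum sits in slot $r$ of $z$, where $A$ is the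
  top set; the second weight simplifies by $(1 - x)/(b - a) = 1/b$. If $r \<notin> A$, the maximum is rejected
  and the reward is zero.\<close>
definition score :: "nat \<Rightarrow> nat \<Rightarrow> real \<Rightarrow> nat \<Rightarrow> (nat \<Rightarrow> real) \<Rightarrow> real" where
  "score a b c r z = (if r \<in> top_set a b z
     then real a / real b * (z r - c) + (\<Sum>k\<in>{..<b} - top_set a b z. z k) / real b else 0)"

text \<open>The top entries enter once each with weight $x$, and each of the $a$ top slots contributes all other
  entries with weight $1/b$, again $x$ in total. The weights of the convex combination are chosen
  so that these two agree: only then the result does not depend on the top set.\<close>
lemma sum_score:
  assumes "a \<le> b" and "0 < b"
  shows "(\<Sum>r<b. score a b c r z) = real a / real b * ((\<Sum>k<b. z k) - real a * c)"
proof -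
  let ?A = "top_set a b z" let ?S = "\<Sum>k\<in>{..<b} - ?A. z k"
  have "(\<Sum>r<b. score a b c r z) = (\<Sum>r\<in>?A. real a / real b * (z r - c) + ?S / real b)"
    unfolding score_def using top_set_subset[of a b z]
    by (intro sum.mono_neutral_cong_right) auto
  also have "\<dots> = real a / real b * ((\<Sum>r\<in>?A. z r) - real a * c) + real a * (?S / real b)"
    using card_top_set[OF assms(1), of z]
    by (simp add: sum.distrib sum_distrib_left[symmetric] sum_subtractf sum_divide_distrib[symmetric])
  also have "(\<Sum>r\<in>?A. z r) = (\<Sum>k<b. z k) - ?S"
    using sum.subset_diff[OF top_set_subset[of a b z], of z] by simp
  finally show ?thesis using assms(2) by (simp add: field_simps)
qed

lemma score_cong:
  assumes z: "\<And>k. k < b \<Longrightarrow> z k = z' k"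
  shows "score a b c r z = score a b c r z'"
proof -
  have *: "top_set a b z = top_set a b z'" using z by (rule top_set_cong)
  have "(\<Sum>k\<in>{..<b} - top_set a b z'. z k) = (\<Sum>k\<in>{..<b} - top_set a b z'. z' k)"
    using z by (intro sum.cong) auto
  moreover have "z r = z' r" if "r \<in> top_set a b z'"
    using that top_set_subset[of a b z'] z by blast
  ultimately show ?thesis unfolding score_def * by simp
qed

lemma borel_measurable_score:
  assumes z: "\<And>k. k < b \<Longrightarrow> (\<lambda>x. z x k) \<in> borel_measurable M" and r: "r < b"
  shows "(\<lambda>x. score a b c r (z x)) \<in> borel_measurable M"
proof -
  have top: "Measurable.pred M (\<lambda>x. k \<in> top_set a b (z x))" for k
    by (rule measurable_top_set[OF z])
  have [measurable]: "(\<lambda>x. \<Sum>k<b. if k \<in> top_set a b (z x) then 0 else z x k) \<in> borel_measurable M"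
  proof (rule borel_measurable_sum)
    fix k assume "k \<in> {..<b}"
    then have [measurable]: "(\<lambda>x. z x k) \<in> borel_measurable M" using z by simp
    note top[measurable]
    show "(\<lambda>x. if k \<in> top_set a b (z x) then 0 else z x k) \<in> borel_measurable M" by measurable
  qed
  have sum: "(\<Sum>k\<in>{..<b} - top_set a b v. v k) = (\<Sum>k<b. if k \<in> top_set a b v then 0 else v k)" for v
    by (intro sum.mono_neutral_cong_left) auto
  have [measurable]: "(\<lambda>x. z x r) \<in> borel_measurable M" using z r .
  note top[measurable]
  show ?thesis unfolding score_def sum by measurable
qed

text \<open>A crude bound that reduces integrability of the score to that of the entries.\<close>
lemma abs_score_le:
  assumes "a \<le> b" "r < b"
  shows "\<bar>score a b c r z\<bar> \<le> 2 * (\<Sum>k<b. \<bar>z k\<bar>) + \<bar>c\<bar>"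
proof -
  let ?S = "\<Sum>k\<in>{..<b} - top_set a b z. z k" let ?T = "\<Sum>k<b. \<bar>z k\<bar>"
  have T: "0 \<le> ?T" by (rule sum_nonneg) simp
  have "\<bar>?S\<bar> \<le> (\<Sum>k\<in>{..<b} - top_set a b z. \<bar>z k\<bar>)" by (rule sum_abs)
  also have "\<dots> \<le> ?T" by (rule sum_mono2) auto
  finally have S: "\<bar>?S\<bar> \<le> ?T" .
  have "\<bar>?S / real b\<bar> \<le> \<bar>?S\<bar> / 1"
    unfolding abs_divide using assms by (intro divide_left_mono) auto
  then have 1: "\<bar>?S / real b\<bar> \<le> ?T" using S by simp
  have "\<bar>z r\<bar> \<le> ?T" using assms by (intro member_le_sum) auto
  then have zc: "\<bar>z r - c\<bar> \<le> ?T + \<bar>c\<bar>" by linarith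
  have "\<bar>real a / real b * (z r - c)\<bar> \<le> 1 * \<bar>z r - c\<bar>"
    unfolding abs_mult using assms by (intro mult_right_mono) auto
  then have 2: "\<bar>real a / real b * (z r - c)\<bar> \<le> ?T + \<bar>c\<bar>" using zc by simp
  have "\<bar>real a / real b * (z r - c) + ?S / real b\<bar> \<le> 2 * ?T + \<bar>c\<bar>"
    by (rule order.trans[OF abs_triangle_ineq]) (use add_mono[OF 2 1] in simp)
  then show ?thesis unfolding score_def using T by (simp split: if_split)
qed

lemma integrable_score:
  assumes P: "prob_space P" and ab: "a \<le> b" and r: "r < b"
    and z: "\<And>k. k < b \<Longrightarrow> integrable P (\<lambda>x. z x k)"
  shows "integrable P (\<lambda>x. score a b c r (z x))"
proof (rule Bochner_Integration.integrable_bound)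
  interpret prob_space P by (rule P)
  show "integrable P (\<lambda>x. 2 * (\<Sum>k<b. \<bar>z x k\<bar>) + \<bar>c\<bar>)"
    using z by (intro Bochner_Integration.integrable_add integrable_mult_right
        Bochner_Integration.integrable_sum integrable_abs) auto
  show "(\<lambda>x. score a b c r (z x)) \<in> borel_measurable P"
    using z r by (intro borel_measurable_score) auto
  show "AE x in P. norm (score a b c r (z x)) \<le> norm (2 * (\<Sum>k<b. \<bar>z x k\<bar>) + \<bar>c\<bar>)"
    using abs_score_le[OF ab r] by (intro AE_I2) (simp add: order.trans[OF _ abs_ge_self])
qed

text \<open>The samples \<open>s\<close> and the slot \<open>r\<close> are constants here, so acceptance is a fixed upward closed set
  of reals and \<open>stopped_value_ge_Max\<close> applies. The bound by the rejected entries holds pointwise,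
  the bound by the maximum only in expectation, which is why they are combined at this stage.\<close>
lemma stopped_value_ge_score:
  assumes P: "prob_space P" and n: "1 \<le> n"
    and Y: "\<And>i. i \<in> {1..n} \<Longrightarrow> Y i \<in> borel_measurable P"
    and nn: "\<And>i \<omega>. i \<in> {1..n} \<Longrightarrow> \<omega> \<in> space P \<Longrightarrow> 0 \<le> Y i \<omega>"
    and int: "integrable P (run_max n Y)"
    and ce: "\<And>i. i \<in> {1..n} \<Longrightarrow> AE \<omega> in P.
      real_cond_exp P (gen_sigma P i Y) (\<lambda>\<omega>. MAX j\<in>{i..n}. Y j \<omega> - Y i \<omega>) \<omega> \<le> c"
    and ab: "a < b" and r: "r < b"
  shows "(\<integral>\<omega>. score a b c r (insert_at r s (run_max n Y \<omega>)) \<partial>P)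
    \<le> (\<integral>\<omega>. stopped_value n (\<lambda>y. r \<in> top_set a b (insert_at r s y)) (\<lambda>i. Y i \<omega>) \<partial>P)"
proof -
  interpret prob_space P by (rule P)
  define Acc where "Acc y \<longleftrightarrow> r \<in> top_set a b (insert_at r s y)" for y
  let ?x = "real a / real b"
  let ?L = "\<lambda>\<omega>. if Acc (run_max n Y \<omega>) then run_max n Y \<omega> - c else 0"
  let ?V = "\<lambda>\<omega>. stopped_value n Acc (\<lambda>i. Y i \<omega>)"
  have up: "mono Acc"
  proof (rule monoI, rule le_boolI)
    fix u v :: real assume le: "u \<le> v" and acc: "Acc u"
    show "Acc v" using acc unfolding Acc_def insert_at_def by (rule top_set_upward[OF _ le])
  qed
  have Acc: "Measurable.pred borel Acc"
    unfolding Acc_def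
  proof (rule measurable_top_set)
    fix k assume "k < b"
    then show "(\<lambda>y. insert_at r s y k) \<in> borel_measurable borel"
      using r by (intro measurable_insert_at[where s = "\<lambda>_. s" and y = "\<lambda>y. y" and b = b]) simp_all
  qed
  note ge = stopped_value_ge_Max[OF P n Y nn int ce up Acc]
  have sc: "score a b c r (insert_at r s (run_max n Y \<omega>)) \<le> ?x * ?L \<omega> + (1 - ?x) * ?V \<omega>"
    if w: "\<omega> \<in> space P" for \<omega>
  proof (cases "Acc (run_max n Y \<omega>)")
    case False
    have "0 \<le> ?V \<omega>" using stopped_value_bounds(1)[OF n, of "\<lambda>i. Y i \<omega>"] nn w by simp
    then show ?thesis using False ab by (simp add: score_def Acc_def)
  next
    case True
    let ?A = "top_set a b (insert_at r s (run_max n Y \<omega>))"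
    have "\<exists>i\<in>{1..n}. Acc (Y i \<omega>)"
      using iffD1[OF mono_pred_Max_iff[OF up n, of "\<lambda>i. Y i \<omega>"]] True unfolding run_max_def .
    then obtain i where i: "i \<in> {1..n}" "first_hit Acc (\<lambda>i. Y i \<omega>) i"
      by (rule first_hit_exists)
    have V: "?V \<omega> = Y i \<omega>" by (rule stopped_value_hit[OF i])
    have Yi: "Y i \<omega> \<le> run_max n Y \<omega>" unfolding run_max_def using i by simp
    have "insert_at r s (run_max n Y \<omega>) k \<le> Y i \<omega>" if k: "k \<in> {..<b} - ?A" for k
    proof -
      have "k \<noteq> r" using k True unfolding Acc_def by auto
      then show ?thesis
        using top_set_dominates[OF _ Yi, of r a b "\<lambda>k. if k < r then s (Suc k) else s k" k] i(2) k
        unfolding first_hit_def Acc_def insert_at_def by auto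
    qed
    then have "(\<Sum>k\<in>{..<b} - ?A. insert_at r s (run_max n Y \<omega>) k) \<le> real (card ({..<b} - ?A)) * Y i \<omega>"
      by (rule sum_bounded_above)
    also have "card ({..<b} - ?A) = b - a"
      using card_top_set[of a b] top_set_subset[of a b] ab by (subst card_Diff_subset) (auto intro: finite_subset)
    finally have "(\<Sum>k\<in>{..<b} - ?A. insert_at r s (run_max n Y \<omega>) k) / real b \<le> (1 - ?x) * Y i \<omega>"
      using ab by (simp add: field_simps of_nat_diff)
    then show ?thesis
      using True V unfolding score_def Acc_def by (simp add: insert_at_def)
  qed
  have isc: "integrable P (\<lambda>\<omega>. score a b c r (insert_at r s (run_max n Y \<omega>)))"
  proof (rule integrable_score[OF P less_imp_le[OF ab] r])
    show "integrable P (\<lambda>\<omega>. insert_at r s (run_max n Y \<omega>) k)" if "k < b" for k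
      unfolding insert_at_def using int by (cases "k = r") simp_all
  qed
  have "(\<integral>\<omega>. score a b c r (insert_at r s (run_max n Y \<omega>)) \<partial>P)
      \<le> (\<integral>\<omega>. ?x * ?L \<omega> + (1 - ?x) * ?V \<omega> \<partial>P)"
    using ge(1,2) sc isc by (intro integral_mono) auto
  also have "\<dots> = ?x * (\<integral>\<omega>. ?L \<omega> \<partial>P) + (1 - ?x) * (\<integral>\<omega>. ?V \<omega> \<partial>P)"
    using ge(1,2) by simp
  also have "\<dots> \<le> ?x * (\<integral>\<omega>. ?V \<omega> \<partial>P) + (1 - ?x) * (\<integral>\<omega>. ?V \<omega> \<partial>P)"
    using ge(3) by (intro add_right_mono mult_left_mono) auto
  also have "\<dots> = (\<integral>\<omega>. ?V \<omega> \<partial>P)" by (simp add: algebra_simps)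
  finally show ?thesis unfolding Acc_def .
qed


section \<open>Independent families and iterated integrals\<close>

text \<open>Joint independence is equality of the joint law with the product of the marginals. The joint law on
  $I \cup J$ is the image under \<open>merge\<close> of the law of the pair of blocks, and by independence of the blocks
  that pair has a product law.\<close>
lemma (in prob_space) indep_vars_Un:
  assumes indI: "indep_vars M' X I" and indJ: "indep_vars M' X J"
    and IJ: "indep_var (PiM I M') (\<lambda>\<omega>. \<lambda>j\<in>I. X j \<omega>) (PiM J M') (\<lambda>\<omega>. \<lambda>j\<in>J. X j \<omega>)"
    and I: "finite I" "finite J" "I \<inter> J = {}" "I \<noteq> {}" "J \<noteq> {}"
  shows "indep_vars M' X (I \<union> J)"
proof -
  let ?VI = "\<lambda>\<omega>. \<lambda>j\<in>I. X j \<omega>" and ?VJ = "\<lambda>\<omega>. \<lambda>j\<in>J. X j \<omega>"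
  obtain i where i: "i \<in> I" using I by auto
  have rvI: "random_variable (M' j) (X j)" if "j \<in> I" for j
    using indI that by (auto simp: indep_vars_def)
  have rvJ: "random_variable (M' j) (X j)" if "j \<in> J" for j
    using indJ that by (auto simp: indep_vars_def)
  have rv: "random_variable (M' j) (X j)" if "j \<in> I \<union> J" for j
    using that rvI rvJ by auto
  have [measurable]: "random_variable (PiM I M') ?VI" "random_variable (PiM J M') ?VJ"
    using rvI rvJ by (auto intro: measurable_restrict)
  (* Product measures need a probability measure at every index, so a law that occurs is repeated
     outside of the two blocks. *)
  define D where "D j = (if j \<in> I \<union> J then distr M (M' j) (X j) else distr M (M' i) (X i))" for j
  have "prob_space (D j)" for j
    unfolding D_def using rv i by (auto intro!: prob_space_distr)
  then interpret product_sigma_finite D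
    unfolding product_sigma_finite_def by (auto intro: prob_space_imp_sigma_finite)
  have D_eq: "PiM L (\<lambda>j. distr M (M' j) (X j)) = PiM L D" if "L \<subseteq> I \<union> J" for L
    using that by (intro PiM_cong) (auto simp: D_def)
  have "distr M (PiM (I \<union> J) M') (\<lambda>\<omega>. \<lambda>j\<in>I \<union> J. X j \<omega>)
      = distr M (PiM (I \<union> J) M') (merge I J \<circ> (\<lambda>\<omega>. (?VI \<omega>, ?VJ \<omega>)))"
    by (intro arg_cong[where f = "distr M (PiM (I \<union> J) M')"]) (auto simp: fun_eq_iff merge_def)
  also have "\<dots> = distr (distr M (PiM I M' \<Otimes>\<^sub>M PiM J M') (\<lambda>\<omega>. (?VI \<omega>, ?VJ \<omega>)))
      (PiM (I \<union> J) M') (merge I J)"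
    by (rule distr_distr[symmetric]) measurable
  also have "distr M (PiM I M' \<Otimes>\<^sub>M PiM J M') (\<lambda>\<omega>. (?VI \<omega>, ?VJ \<omega>))
      = distr M (PiM I M') ?VI \<Otimes>\<^sub>M distr M (PiM J M') ?VJ"
    using IJ by (simp add: indep_var_distribution_eq)
  also have "distr M (PiM I M') ?VI = PiM I D"
    using indep_vars_iff_distr_eq_PiM'[OF I(4) rvI] indI D_eq[of I] by simp
  also have "distr M (PiM J M') ?VJ = PiM J D"
    using indep_vars_iff_distr_eq_PiM'[OF I(5) rvJ] indJ D_eq[of J] by simp
  also have "distr (PiM I D \<Otimes>\<^sub>M PiM J D) (PiM (I \<union> J) M') (merge I J)
      = distr (PiM I D \<Otimes>\<^sub>M PiM J D) (PiM (I \<union> J) D) (merge I J)"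
    by (intro distr_cong refl sets_PiM_cong) (auto simp: D_def)
  also have "\<dots> = PiM (I \<union> J) D" using I by (intro distr_merge)
  finally have eq: "distr M (PiM (I \<union> J) M') (\<lambda>\<omega>. \<lambda>j\<in>I \<union> J. X j \<omega>)
      = PiM (I \<union> J) (\<lambda>j. distr M (M' j) (X j))"
    unfolding D_eq[OF order_refl] .
  show ?thesis
    by (rule iffD2[OF indep_vars_iff_distr_eq_PiM' eq]) (use I rv in auto)
qed

lemma (in prob_space) indep_vars_singleton:
  assumes "random_variable (M' i) (X i)"
  shows "indep_vars M' X {i}"
proof -
  have "{X i -` A \<inter> space M |A. A \<in> sets (M' i)} \<subseteq> events"
    using assms by (auto intro: measurable_sets)
  then show ?thesis
    unfolding indep_vars_def2 using assms by (auto simp: indep_sets_def subset_singleton_iff)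
qed

text \<open>Independence lets one variable be frozen while the other is integrated out over the original
  probability space, where assumptions about conditional expectations can still be used.\<close>
lemma (in prob_space) indep_var_integral_iterate:
  fixes h :: "'b \<times> 'b \<Rightarrow> real"
  assumes ind: "indep_var MA X MB W"
    and h [measurable]: "h \<in> borel_measurable (MA \<Otimes>\<^sub>M MB)"
    and int: "integrable M (\<lambda>\<omega>. h (X \<omega>, W \<omega>))"
  shows "integrable (distr M MB W) (\<lambda>w. \<integral>\<omega>. h (X \<omega>, w) \<partial>M)"
    and "(\<integral>w. (\<integral>\<omega>. h (X \<omega>, w) \<partial>M) \<partial>distr M MB W) = (\<integral>\<omega>. h (X \<omega>, W \<omega>) \<partial>M)"
proof -
  have [measurable]: "random_variable MA X" "random_variable MB W"
    and eq: "distr M MA X \<Otimes>\<^sub>M distr M MB W = distr M (MA \<Otimes>\<^sub>M MB) (\<lambda>x. (X x, W x))"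
    using ind by (simp_all add: indep_var_distribution_eq)
  interpret A: prob_space "distr M MA X" by (rule prob_space_distr) simp
  interpret B: prob_space "distr M MB W" by (rule prob_space_distr) simp
  interpret AB: pair_sigma_finite "distr M MA X" "distr M MB W" ..
  have "integrable (distr M (MA \<Otimes>\<^sub>M MB) (\<lambda>x. (X x, W x))) h"
    using int by (subst integrable_distr_eq) auto
  then have hint: "integrable (distr M MA X \<Otimes>\<^sub>M distr M MB W) (case_prod (\<lambda>x w. h (x, w)))"
    unfolding eq by simp
  have inner: "(\<integral>x. h (x, w) \<partial>distr M MA X) = (\<integral>\<omega>. h (X \<omega>, w) \<partial>M)" if "w \<in> space (distr M MB W)" for w
  proof -
    have [measurable]: "w \<in> space MB" using that by simp
    show ?thesis by (rule integral_distr) measurable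
  qed
  have "integrable (distr M MB W) (\<lambda>w. \<integral>x. h (x, w) \<partial>distr M MA X)"
    by (rule AB.integrable_snd[OF hint])
  then show "integrable (distr M MB W) (\<lambda>w. \<integral>\<omega>. h (X \<omega>, w) \<partial>M)"
    by (subst (asm) Bochner_Integration.integrable_cong[OF refl inner]) 
  have "(\<integral>w. (\<integral>\<omega>. h (X \<omega>, w) \<partial>M) \<partial>distr M MB W) = (\<integral>w. (\<integral>x. h (x, w) \<partial>distr M MA X) \<partial>distr M MB W)"
    by (rule Bochner_Integration.integral_cong[OF refl inner[symmetric]])
  also have "\<dots> = integral\<^sup>L (distr M MA X \<Otimes>\<^sub>M distr M MB W) (case_prod (\<lambda>x w. h (x, w)))"
    by (rule AB.integral_snd[OF hint])
  also have "\<dots> = (\<integral>\<omega>. h (X \<omega>, W \<omega>) \<partial>M)"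
    unfolding eq by (subst integral_distr) auto
  finally show "(\<integral>w. (\<integral>\<omega>. h (X \<omega>, w) \<partial>M) \<partial>distr M MB W) = (\<integral>\<omega>. h (X \<omega>, W \<omega>) \<partial>M)" .
qed

lemma (in prob_space) indep_var_integral_mono:
  fixes f g :: "'b \<times> 'b \<Rightarrow> real"
  assumes ind: "indep_var MA X MB W"
    and meas: "f \<in> borel_measurable (MA \<Otimes>\<^sub>M MB)" "g \<in> borel_measurable (MA \<Otimes>\<^sub>M MB)"
    and int: "integrable M (\<lambda>\<omega>. f (X \<omega>, W \<omega>))" "integrable M (\<lambda>\<omega>. g (X \<omega>, W \<omega>))"
    and le: "\<And>w. w \<in> space MB \<Longrightarrow> (\<integral>\<omega>. f (X \<omega>, w) \<partial>M) \<le> (\<integral>\<omega>. g (X \<omega>, w) \<partial>M)"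
  shows "(\<integral>\<omega>. f (X \<omega>, W \<omega>) \<partial>M) \<le> (\<integral>\<omega>. g (X \<omega>, W \<omega>) \<partial>M)"
  unfolding indep_var_integral_iterate(2)[OF ind meas(1) int(1), symmetric]
    indep_var_integral_iterate(2)[OF ind meas(2) int(2), symmetric]
  by (intro integral_mono indep_var_integral_iterate(1)[OF ind] meas int le) auto


section \<open>Exchangeability of the slots\<close>

text \<open>With the maximum stored at index $m$ and the samples at $1, \dots, b - 1$, this is the index of the
  variable that occupies slot $k$ when the maximum is inserted at slot $r$.\<close>
definition arrange :: "nat \<Rightarrow> nat \<Rightarrow> nat \<Rightarrow> nat" where
  "arrange m r = (\<lambda>k. if k < r then Suc k else k)(r := m)"

lemma arrange_in: "r < b \<Longrightarrow> k < b \<Longrightarrow> arrange m r k \<in> insert m {1..<b}"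
  by (auto simp: arrange_def)

lemma inj_on_arrange:
  assumes "m \<notin> {1..<b}" "r < b"
  shows "inj_on (arrange m r) {..<b}"
  using assms by (auto simp: inj_on_def arrange_def split: if_splits)

text \<open>For every slot $r$ the inserted list consists of $b$ distinct members of one i.i.d. family, so its law
  is the same product measure. This replaces the statement that the rank of the maximum is uniform.\<close>
lemma (in prob_space) distr_arrange:
  assumes ind: "indep_vars (\<lambda>_. borel) X (insert m {1..<b})"
    and D: "\<And>j. j \<in> insert m {1..<b} \<Longrightarrow> distr M borel (X j) = D"
    and m: "m \<notin> {1..<b}" and r: "r < b"
  shows "distr M (PiM {..<b} (\<lambda>_. borel)) (\<lambda>\<omega>. \<lambda>k\<in>{..<b}. X (arrange m r k) \<omega>) = PiM {..<b} (\<lambda>_. D)"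
proof -
  let ?I = "insert m {1..<b}"
  have rv: "random_variable borel (X j)" if "j \<in> ?I" for j
    using ind that by (auto simp: indep_vars_def)
  have prob: "prob_space (distr M borel (X j))" if "j \<in> ?I" for j
    using rv[OF that] by (rule prob_space_distr)
  let ?V = "\<lambda>\<omega>. \<lambda>j\<in>?I. X j \<omega>"
  have V: "random_variable (PiM ?I (\<lambda>_. borel)) ?V" using rv by (rule measurable_restrict)
  have arr: "arrange m r \<in> {..<b} \<rightarrow> ?I" using arrange_in[OF r] by auto
  have law: "distr M (PiM ?I (\<lambda>_. borel)) ?V = PiM ?I (\<lambda>j. distr M borel (X j))"
    using indep_vars_iff_distr_eq_PiM'[of ?I X "\<lambda>_. borel"] rv ind by blast
  have "distr M (PiM {..<b} (\<lambda>_. borel)) (\<lambda>\<omega>. \<lambda>k\<in>{..<b}. X (arrange m r k) \<omega>)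
    = distr M (PiM {..<b} (\<lambda>_. borel)) ((\<lambda>f. \<lambda>k\<in>{..<b}. f (arrange m r k)) \<circ> ?V)"
    using arr by (intro arg_cong[where f = "distr M _"]) (auto simp: fun_eq_iff Pi_iff)
  also have "\<dots> = distr (distr M (PiM ?I (\<lambda>_. borel)) ?V) (PiM {..<b} (\<lambda>_. borel))
      (\<lambda>f. \<lambda>k\<in>{..<b}. f (arrange m r k))"
  proof (rule distr_distr[symmetric, OF _ V])
    show "(\<lambda>f. \<lambda>k\<in>{..<b}. f (arrange m r k)) \<in> measurable (PiM ?I (\<lambda>_. borel)) (PiM {..<b} (\<lambda>_. borel))"
      using arr by (intro measurable_restrict measurable_component_singleton) auto
  qed
  also have "\<dots> = distr (PiM ?I (\<lambda>j. distr M borel (X j)))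
      (PiM {..<b} (\<lambda>k. distr M borel (X (arrange m r k)))) (\<lambda>f. \<lambda>k\<in>{..<b}. f (arrange m r k))"
    unfolding law by (intro distr_cong refl sets_PiM_cong) auto
  also have "\<dots> = PiM {..<b} (\<lambda>k. distr M borel (X (arrange m r k)))"
    using prob inj_on_arrange[OF m r] arr by (rule distr_PiM_reindex)
  also have "\<dots> = PiM {..<b} (\<lambda>_. D)"
    using D funcset_mem[OF arr] by (intro PiM_cong) blast+
  finally show ?thesis .
qed

text \<open>All arrangements have the same law, so the scores of the different slots can be evaluated on one
  common arrangement, where \<open>sum_score\<close> adds them up.\<close>
lemma (in prob_space) sum_expectation_score:
  assumes ind: "indep_vars (\<lambda>_. borel) X (insert m {1..<b})"
    and D: "\<And>j. j \<in> insert m {1..<b} \<Longrightarrow> distr M borel (X j) = distr M borel (X m)"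
    and m: "m \<notin> {1..<b}" and ab: "a \<le> b" "0 < b"
    and int: "integrable M (X m)"
  shows "(\<Sum>r<b. expectation (\<lambda>\<omega>. score a b c r (\<lambda>k. X (arrange m r k) \<omega>)))
    = real a * expectation (X m) - real a * (real a / real b) * c"
proof -
  let ?I = "insert m {1..<b}" and ?Q = "PiM {..<b} (\<lambda>_. borel) :: (nat \<Rightarrow> real) measure"
  let ?Z = "\<lambda>r \<omega>. \<lambda>k\<in>{..<b}. X (arrange m r k) \<omega>"
  have rv: "random_variable borel (X j)" if "j \<in> ?I" for j
    using ind that by (auto simp: indep_vars_def)
  have intj: "integrable M (X j)" "expectation (X j) = expectation (X m)" if j: "j \<in> ?I" for j
  proof -
    have "integrable (distr M borel (X j)) (\<lambda>x::real. x)"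
      unfolding D[OF j] using int rv[of m] by (subst integrable_distr_eq) auto
    then show "integrable M (X j)" using rv[OF j] by (subst (asm) integrable_distr_eq) auto
    have "expectation (X j) = (\<integral>x. x \<partial>distr M borel (X j))"
      using rv[OF j] by (subst integral_distr) auto
    also have "\<dots> = expectation (X m)"
      unfolding D[OF j] using rv[of m] by (subst integral_distr) auto
    finally show "expectation (X j) = expectation (X m)" .
  qed
  have Z: "random_variable ?Q (?Z r)" if "r < b" for r
    using rv arrange_in[OF that] by (intro measurable_restrict) auto
  have sc: "score a b c r \<in> borel_measurable ?Q" if "r < b" for r
    using borel_measurable_score[of b "\<lambda>x. x" ?Q r a c] that by simp
  have restr: "score a b c r (\<lambda>k. X (arrange m s k) \<omega>) = score a b c r (?Z s \<omega>)" for r s \<omega>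
    by (rule score_cong) simp
  have "expectation (\<lambda>\<omega>. score a b c r (\<lambda>k. X (arrange m r k) \<omega>))
      = expectation (\<lambda>\<omega>. score a b c r (\<lambda>k. X (arrange m 0 k) \<omega>))" if r: "r < b" for r
  proof -
    have "expectation (\<lambda>\<omega>. score a b c r (?Z r \<omega>)) = (\<integral>z. score a b c r z \<partial>distr M ?Q (?Z r))"
      by (rule integral_distr[symmetric, OF Z[OF r] sc[OF r]])
    also have "distr M ?Q (?Z r) = distr M ?Q (?Z 0)"
      using distr_arrange[OF ind D m r] distr_arrange[OF ind D m ab(2)] by simp
    also have "(\<integral>z. score a b c r z \<partial>distr M ?Q (?Z 0)) = expectation (\<lambda>\<omega>. score a b c r (?Z 0 \<omega>))"
      by (rule integral_distr[OF Z[OF ab(2)] sc[OF r]])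
    finally show ?thesis unfolding restr .
  qed
  then have "(\<Sum>r<b. expectation (\<lambda>\<omega>. score a b c r (\<lambda>k. X (arrange m r k) \<omega>)))
      = (\<Sum>r<b. expectation (\<lambda>\<omega>. score a b c r (\<lambda>k. X (arrange m 0 k) \<omega>)))" by simp
  also have "\<dots> = expectation (\<lambda>\<omega>. \<Sum>r<b. score a b c r (\<lambda>k. X (arrange m 0 k) \<omega>))"
    using intj(1) arrange_in[OF ab(2)] ab
    by (intro Bochner_Integration.integral_sum[symmetric] integrable_score prob_space_axioms) auto
  also have "\<dots> = expectation (\<lambda>\<omega>. real a / real b * ((\<Sum>k<b. X (arrange m 0 k) \<omega>) - real a * c))"
    by (simp add: sum_score[OF ab])
  also have "\<dots> = real a / real b * ((\<Sum>k<b. expectation (X (arrange m 0 k))) - real a * c)"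
  proof -
    have i: "integrable M (\<lambda>\<omega>. X (arrange m 0 k) \<omega>)" if "k \<in> {..<b}" for k
      using intj(1) arrange_in[OF ab(2)] that by auto
    have "expectation (\<lambda>\<omega>. (\<Sum>k<b. X (arrange m 0 k) \<omega>) - real a * c)
        = expectation (\<lambda>\<omega>. \<Sum>k<b. X (arrange m 0 k) \<omega>) - real a * c"
      by (subst Bochner_Integration.integral_diff) (auto intro!: Bochner_Integration.integrable_sum i simp: prob_space)
    also have "expectation (\<lambda>\<omega>. \<Sum>k<b. X (arrange m 0 k) \<omega>) = (\<Sum>k<b. expectation (X (arrange m 0 k)))"
      using i by (rule Bochner_Integration.integral_sum)
    finally show ?thesis by simp
  qed
  also have "(\<Sum>k<b. expectation (X (arrange m 0 k))) = real b * expectation (X m)"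
    using intj(2)[OF arrange_in[OF ab(2)]] by simp
  finally show ?thesis using ab by (simp add: field_simps)
qed


section \<open>The guarantee of the rule\<close>

definition threshold_rule :: "nat \<Rightarrow> nat \<Rightarrow> decision" where
  "threshold_rule a b i s y u \<longleftrightarrow> accepts a b s u (y i)"

lemma stopping_rule_threshold_rule:
  assumes "b \<le> K + 1"
  shows "stopping_rule n K (threshold_rule a b)"
  unfolding stopping_rule_def
proof
  fix i assume i: "i \<in> {1..n}"
  let ?M = "PiM {1..K} (\<lambda>_. borel) \<Otimes>\<^sub>M PiM {1..i} (\<lambda>_. borel) \<Otimes>\<^sub>M borel
    :: ((nat \<Rightarrow> real) \<times> (nat \<Rightarrow> real) \<times> real) measure"
  have "Measurable.pred ?M (\<lambda>x. accepts a b (fst x) (snd (snd x)) (fst (snd x) i))"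
  proof (rule measurable_accepts)
    fix j assume "j \<in> {1..<b}"
    then have j: "j \<in> {1..K}" using assms by auto
    show "(\<lambda>x. fst x j) \<in> borel_measurable ?M"
      by (rule measurable_compose[OF measurable_fst measurable_component_singleton[OF j]])
  next
    have i': "i \<in> {1..i}" using i by simp
    have "(\<lambda>x. fst (snd x)) \<in> measurable ?M (PiM {1..i} (\<lambda>_. borel))" by measurable
    then show "(\<lambda>x. fst (snd x) i) \<in> borel_measurable ?M"
      by (rule measurable_compose[OF _ measurable_component_singleton[OF i']])
    show "(\<lambda>x. snd (snd x)) \<in> borel_measurable ?M" by measurable
  qed
  then show "Measurable.pred ?M (\<lambda>(s, y, u). threshold_rule a b i s y u)"
    unfolding threshold_rule_def by (simp add: case_prod_beta)
qed

lemma reward_eq_stopped_value: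
  "Y (the_enat (induced_time n K (threshold_rule a b) S Y U \<omega>)) \<omega>
    * indicator {\<omega>. induced_time n K (threshold_rule a b) S Y U \<omega> \<le> enat n} \<omega>
   = stopped_value n (accepts a b (\<lambda>k\<in>{1..K}. S k \<omega>) (U \<omega>)) (\<lambda>i. Y i \<omega>)"
proof -
  let ?Acc = "accepts a b (\<lambda>k\<in>{1..K}. S k \<omega>) (U \<omega>)"
  let ?d = "threshold_rule a b"
  have st: "stops_at K ?d S Y U i \<omega> \<longleftrightarrow> ?Acc (Y i \<omega>)" if "i \<in> {1..n}" for i
    unfolding stops_at_def threshold_rule_def using that by simp
  show ?thesis
  proof (cases "\<exists>i\<in>{1..n}. ?Acc (Y i \<omega>)")
    case True
    then obtain i where i: "i \<in> {1..n}" "first_hit ?Acc (\<lambda>i. Y i \<omega>) i" by (rule first_hit_exists)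
    have "(LEAST i. i \<in> {1..n} \<and> stops_at K ?d S Y U i \<omega>) = i"
    proof (rule Least_equality)
      show "i \<in> {1..n} \<and> stops_at K ?d S Y U i \<omega>"
        using i st[OF i(1)] unfolding first_hit_def by blast
      fix j assume j: "j \<in> {1..n} \<and> stops_at K ?d S Y U j \<omega>"
      show "i \<le> j"
      proof (rule ccontr)
        assume "\<not> i \<le> j"
        then have "j \<in> {1..<i}" using j by auto
        then have "\<not> ?Acc (Y j \<omega>)" using i(2) unfolding first_hit_def by blast
        then show False using j st by blast
      qed
    qed
    moreover have "\<exists>i\<in>{1..n}. stops_at K ?d S Y U i \<omega>" using True st by blast
    ultimately have "induced_time n K ?d S Y U \<omega> = enat i" unfolding induced_time_def by simp
    then show ?thesis using i(1) stopped_value_hit[OF i] by simp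
  next
    case False
    then have "\<not> (\<exists>i\<in>{1..n}. stops_at K ?d S Y U i \<omega>)" using st by blast
    then have "induced_time n K ?d S Y U \<omega> = \<infinity>" unfolding induced_time_def by (rule if_not_P)
    moreover have "stopped_value n ?Acc (\<lambda>i. Y i \<omega>) = 0"
      using False by (intro stopped_value_no_hit) blast
    ultimately show ?thesis by simp
  qed
qed

text \<open>The inequality of \<open>stopped_value_ge_score\<close> holds for each frozen outcome of samples and seed, and
  independence of the observations integrates it over these outcomes. The seed is independent of the
  maximum and the samples together, so the slot averages the expected scores with equal weights $1/b$.\<close>
lemma threshold_rule_reward:
  assumes P: "prob_space P" and n: "1 \<le> n"
    and Y: "\<And>i. i \<in> {1..n} \<Longrightarrow> Y i \<in> borel_measurable P"
    and nn: "\<And>i \<omega>. i \<in> {1..n} \<Longrightarrow> \<omega> \<in> space P \<Longrightarrow> 0 \<le> Y i \<omega>"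
    and int: "integrable P (run_max n Y)"
    and ce: "\<And>i. i \<in> {1..n} \<Longrightarrow> AE \<omega> in P.
      real_cond_exp P (gen_sigma P i Y) (\<lambda>\<omega>. MAX j\<in>{i..n}. Y j \<omega> - Y i \<omega>) \<omega> \<le> c"
    and sa: "sample_access P n K Y S U"
    and ab: "0 < a" "a < b" "b \<le> K + 1"
  shows "real a / real b * (\<integral>\<omega>. run_max n Y \<omega> \<partial>P) - (real a / real b)\<^sup>2 * c
    \<le> (\<integral>\<omega>. stopped_value n (accepts a b (\<lambda>k\<in>{1..K}. S k \<omega>) (U \<omega>)) (\<lambda>i. Y i \<omega>) \<partial>P)"
proof -
  interpret prob_space P by (rule P)
  (* One family for all random inputs: the seed at 0, the samples at 1, ..., K, and the maximum at the
     first free index. *)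
  define m where "m = K + 1"
  define X where "X = (S(0 := U))(m := run_max n Y)"
  have X0: "X 0 = U" and Xm: "X m = run_max n Y" and Xk: "\<And>k. k \<in> {1..K} \<Longrightarrow> X k = S k"
    and XW: "\<And>k. k \<in> {0..K} \<Longrightarrow> X k = (S(0 := U)) k"
    unfolding X_def m_def by auto
  let ?MY = "PiM {1..n} (\<lambda>_. borel) :: (nat \<Rightarrow> real) measure"
  let ?MW = "PiM {0..K} (\<lambda>_. borel) :: (nat \<Rightarrow> real) measure"
  let ?YV = "\<lambda>\<omega>. \<lambda>i\<in>{1..n}. Y i \<omega>" and ?WV = "\<lambda>\<omega>. \<lambda>k\<in>{0..K}. (S(0 := U)) k \<omega>"
  let ?max = "\<lambda>y. MAX i\<in>{1..n}. y i :: real"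
  have indW: "indep_vars (\<lambda>_. borel) (S(0 := U)) {0..K}"
    and indYW: "indep_var ?MY ?YV ?MW ?WV"
    and lawU: "distr P borel U = uniform_measure lborel {0..1}"
    and lawS: "\<And>k. k \<in> {1..K} \<Longrightarrow> distr P borel (S k) = distr P borel (run_max n Y)"
    using sa unfolding sample_access_def by auto
  have max_meas: "?max \<in> borel_measurable ?MY"
    using n by (intro borel_measurable_Max_image measurable_component_singleton) auto
  have max_YV: "?max (?YV \<omega>) = run_max n Y \<omega>" for \<omega>
    unfolding run_max_def by (intro arg_cong[where f = Max] image_cong) auto

  (* The maximum is a function of the observations, hence independent of the samples and the seed. *)
  have indX: "indep_vars (\<lambda>_. borel) X (insert m {0..K})"
  proof -
    have "indep_vars (\<lambda>_. borel) X ({m} \<union> {0..K})"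
    proof (rule indep_vars_Un)
      show "indep_vars (\<lambda>_. borel) X {m}"
        using int by (intro indep_vars_singleton) (simp add: Xm)
      show "indep_vars (\<lambda>_. borel) X {0..K}"
        using indW by (rule iffD1[OF indep_vars_cong, rotated -1]) (simp_all add: XW)
      have "indep_var (PiM {m} (\<lambda>_. borel)) ((\<lambda>y. \<lambda>j\<in>{m}. ?max y) \<circ> ?YV) ?MW ((\<lambda>w. w) \<circ> ?WV)"
        using indYW by (rule indep_var_compose) (auto intro!: measurable_restrict max_meas)
      moreover have "(\<lambda>y. \<lambda>j\<in>{m}. ?max y) \<circ> ?YV = (\<lambda>\<omega>. \<lambda>j\<in>{m}. X j \<omega>)"
        unfolding comp_def max_YV by (auto simp: fun_eq_iff Xm)
      moreover have "(\<lambda>w. w) \<circ> ?WV = (\<lambda>\<omega>. \<lambda>j\<in>{0..K}. X j \<omega>)"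
        by (auto simp: fun_eq_iff XW simp del: fun_upd_apply)
      ultimately show "indep_var (PiM {m} (\<lambda>_. borel)) (\<lambda>\<omega>. \<lambda>j\<in>{m}. X j \<omega>)
          ?MW (\<lambda>\<omega>. \<lambda>j\<in>{0..K}. X j \<omega>)" by simp
    qed (auto simp: m_def)
    then show ?thesis by simp
  qed
  have rvX: "random_variable borel (X j)" if "j \<in> insert m {0..K}" for j
    using indX that by (auto simp: indep_vars_def)
  have lawX: "distr P borel (X j) = distr P borel (X m)" if "j \<in> insert m {1..<b}" for j
    using that lawS Xk ab by (cases "j = m") (auto simp: Xm)
  have mb: "m \<notin> {1..<b}" and sub: "insert m {1..<b} \<subseteq> insert m {0..K}"
    using ab unfolding m_def by auto
  have indXb: "indep_vars (\<lambda>_. borel) X (insert m {1..<b})"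
    using indX sub by (rule indep_vars_subset)
  have intX: "integrable P (X j)" if j: "j \<in> insert m {1..<b}" for j
  proof -
    have "integrable (distr P borel (X j)) (\<lambda>x::real. x)"
      unfolding lawX[OF j] using int rvX[of m] by (subst integrable_distr_eq) (auto simp: Xm)
    then show "integrable P (X j)" using rvX[of j] j sub by (subst (asm) integrable_distr_eq) auto
  qed

  (* The vector w carries the seed at index 0 and the samples after it. Both f, the reward, and g,
     the score at the slot that the seed selects, are functions of the observations and w. *)
  let ?T = "\<lambda>w. \<lambda>k\<in>{1..K}. w k :: real"
  define f where "f p = stopped_value n (accepts a b (?T (snd p)) (snd p 0)) (fst p)"
    for p :: "(nat \<Rightarrow> real) \<times> (nat \<Rightarrow> real)"
  define g where "g p = (\<Sum>r<b. if slot b (snd p 0) r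
      then score a b c r (insert_at r (?T (snd p)) (?max (fst p))) else 0)"
    for p :: "(nat \<Rightarrow> real) \<times> (nat \<Rightarrow> real)"
  have TW: "?T (?WV \<omega>) = (\<lambda>k\<in>{1..K}. S k \<omega>)" and W0: "?WV \<omega> 0 = U \<omega>" for \<omega>
    by auto
  have sv_restr: "stopped_value n Acc (\<lambda>i\<in>{1..n}. y i) = stopped_value n Acc y" for Acc y
    unfolding stopped_value_def by (intro sum.cong refl) (auto simp: first_hit_def)
  have score_insert_at: "score a b c r (insert_at r (\<lambda>k\<in>{1..K}. S k \<omega>) (run_max n Y \<omega>))
      = score a b c r (\<lambda>k. X (arrange m r k) \<omega>)" if "r < b" for r \<omega>
  proof (rule score_cong)
    fix k assume k: "k < b"
    show "insert_at r (\<lambda>k\<in>{1..K}. S k \<omega>) (run_max n Y \<omega>) k = X (arrange m r k) \<omega>"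
    proof (cases "k = r")
      case True
      then show ?thesis by (simp add: insert_at_def arrange_def Xm)
    next
      case False
      have "(if k < r then Suc k else k) \<in> {1..K}"
        using False k that ab by auto
      then show ?thesis using False Xk by (auto simp: insert_at_def arrange_def)
    qed
  qed
  have comp: "(\<lambda>p. snd p k) \<in> borel_measurable (?MY \<Otimes>\<^sub>M ?MW)" if "k \<in> {0..K}" for k
    by (rule measurable_compose[OF measurable_snd measurable_component_singleton[OF that]])
  have compT: "(\<lambda>p. ?T (snd p) j) \<in> borel_measurable (?MY \<Otimes>\<^sub>M ?MW)" if "j \<in> {1..<b}" for j
    using comp[of j] that ab by auto
  have compY: "(\<lambda>p. fst p i) \<in> borel_measurable (?MY \<Otimes>\<^sub>M ?MW)" if "i \<in> {1..n}" for i
    by (rule measurable_compose[OF measurable_fst measurable_component_singleton[OF that]])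
  have compM: "(\<lambda>p. ?max (fst p)) \<in> borel_measurable (?MY \<Otimes>\<^sub>M ?MW)"
    by (rule measurable_compose[OF measurable_fst max_meas])
  have f_meas: "f \<in> borel_measurable (?MY \<Otimes>\<^sub>M ?MW)"
    unfolding f_def using compT compY comp[of 0]
    by (intro borel_measurable_stopped_value measurable_accepts) auto
  have g_meas: "g \<in> borel_measurable (?MY \<Otimes>\<^sub>M ?MW)"
    unfolding g_def
  proof (rule borel_measurable_sum)
    fix r assume "r \<in> {..<b}"
    then have [measurable]: "(\<lambda>p. score a b c r (insert_at r (?T (snd p)) (?max (fst p))))
        \<in> borel_measurable (?MY \<Otimes>\<^sub>M ?MW)"
      using compT compM by (intro borel_measurable_score measurable_insert_at[where b = b]) auto
    have [measurable]: "(\<lambda>p. snd p 0) \<in> borel_measurable (?MY \<Otimes>\<^sub>M ?MW)" by (rule comp) simp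
    show "(\<lambda>p. if slot b (snd p 0) r then score a b c r (insert_at r (?T (snd p)) (?max (fst p))) else 0)
        \<in> borel_measurable (?MY \<Otimes>\<^sub>M ?MW)"
      unfolding slot_def by measurable
  qed
  have f_eq: "f (?YV \<omega>, ?WV \<omega>)
      = stopped_value n (accepts a b (\<lambda>k\<in>{1..K}. S k \<omega>) (U \<omega>)) (\<lambda>i. Y i \<omega>)" for \<omega>
    unfolding f_def fst_conv snd_conv TW W0 sv_restr ..
  have g_eq: "g (?YV \<omega>, ?WV \<omega>)
      = (\<Sum>r<b. if slot b (U \<omega>) r then score a b c r (\<lambda>k. X (arrange m r k) \<omega>) else 0)" for \<omega>
    unfolding g_def fst_conv snd_conv TW W0 max_YV by (intro sum.cong refl) (simp only: score_insert_at lessThan_iff)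

  let ?sc = "\<lambda>r \<omega>. score a b c r (\<lambda>k. X (arrange m r k) \<omega>)"
  let ?ind = "\<lambda>r \<omega>. indicator {\<omega> \<in> space P. slot b (U \<omega>) r} \<omega> :: real"
  have rvU: "random_variable borel U" using rvX[of 0] by (simp add: X0)
  have slot_ev: "{\<omega> \<in> space P. slot b (U \<omega>) r} \<in> events" for r
  proof -
    note rvU[measurable]
    show ?thesis unfolding slot_def by measurable
  qed
  have isc: "integrable P (?sc r)" if "r < b" for r
    using intX arrange_in[OF that] ab that by (intro integrable_score P) auto
  have if_ind: "(if slot b (U \<omega>) r then ?sc r \<omega> else 0) = ?ind r \<omega> * ?sc r \<omega>" if "\<omega> \<in> space P" for r \<omega>
    using that by simp
  have slot_term: "integrable P (\<lambda>\<omega>. ?ind r \<omega> * ?sc r \<omega>)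
      \<and> expectation (\<lambda>\<omega>. ?ind r \<omega> * ?sc r \<omega>) = 1 / real b * expectation (?sc r)" if r: "r < b" for r
  proof -
    let ?I = "insert m {1..<b}"
    have "indep_var (PiM {0} (\<lambda>_. borel)) (\<lambda>\<omega>. \<lambda>i\<in>{0}. X i \<omega>)
        (PiM ?I (\<lambda>_. borel)) (\<lambda>\<omega>. \<lambda>i\<in>?I. X i \<omega>)"
      using indX by (rule indep_var_restrict) (use sub in \<open>auto simp: m_def\<close>)
    moreover have "(\<lambda>v. if slot b (v 0) r then 1 else 0 :: real) \<in> borel_measurable (PiM {0::nat} (\<lambda>_. borel))"
    proof -
      have [measurable]: "(\<lambda>v. v 0) \<in> borel_measurable (PiM {0::nat} (\<lambda>_. borel :: real measure))"
        by (rule measurable_component_singleton) simp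
      show ?thesis unfolding slot_def by measurable
    qed
    moreover have "(\<lambda>v. score a b c r (\<lambda>k. v (arrange m r k)))
        \<in> borel_measurable (PiM ?I (\<lambda>_. borel :: real measure))"
      using arrange_in[OF r] r by (intro borel_measurable_score measurable_component_singleton) auto
    ultimately have "indep_var borel ((\<lambda>v. if slot b (v 0) r then 1 else 0 :: real) \<circ> (\<lambda>\<omega>. \<lambda>i\<in>{0}. X i \<omega>))
        borel ((\<lambda>v. score a b c r (\<lambda>k. v (arrange m r k))) \<circ> (\<lambda>\<omega>. \<lambda>i\<in>?I. X i \<omega>))"
      by (rule indep_var_compose)
    moreover have "(\<lambda>v. if slot b (v 0) r then 1 else 0 :: real) \<circ> (\<lambda>\<omega>. \<lambda>i\<in>{0}. X i \<omega>)
        = (\<lambda>\<omega>. if slot b (U \<omega>) r then 1 else 0)"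
      by (auto simp: fun_eq_iff X0)
    moreover have "(\<lambda>v. score a b c r (\<lambda>k. v (arrange m r k))) \<circ> (\<lambda>\<omega>. \<lambda>i\<in>?I. X i \<omega>) = ?sc r"
      using arrange_in[OF r] by (auto simp: fun_eq_iff intro!: score_cong)
    ultimately have ind: "indep_var borel (\<lambda>\<omega>. if slot b (U \<omega>) r then 1 else 0) borel (?sc r)"
      by simp
    have one: "(if slot b (U \<omega>) r then 1 else 0) = ?ind r \<omega>" if "\<omega> \<in> space P" for \<omega>
      using that by simp
    have i1: "integrable P (?ind r)"
      using slot_ev[of r] by (intro integrable_real_indicator) (auto simp: emeasure_eq_measure)
    have i2: "integrable P (\<lambda>\<omega>. if slot b (U \<omega>) r then 1 else 0 :: real)"
      by (rule iffD2[OF Bochner_Integration.integrable_cong[OF refl one] i1])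
    have eq: "(if slot b (U \<omega>) r then 1 else 0) * ?sc r \<omega> = ?ind r \<omega> * ?sc r \<omega>" if "\<omega> \<in> space P" for \<omega>
      using that by simp
    have "integrable P (\<lambda>\<omega>. ?ind r \<omega> * ?sc r \<omega>)"
      by (rule iffD1[OF Bochner_Integration.integrable_cong[OF refl eq] indep_var_integrable[OF ind i2 isc[OF r]]])
    moreover have "expectation (\<lambda>\<omega>. ?ind r \<omega> * ?sc r \<omega>)
        = expectation (\<lambda>\<omega>. (if slot b (U \<omega>) r then 1 else 0) * ?sc r \<omega>)"
      by (rule Bochner_Integration.integral_cong[OF refl eq[symmetric]])
    moreover have "\<dots> = expectation (\<lambda>\<omega>. if slot b (U \<omega>) r then 1 else 0) * expectation (?sc r)"
      by (rule indep_var_lebesgue_integral[OF ind i2 isc[OF r]])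
    moreover have "expectation (\<lambda>\<omega>. if slot b (U \<omega>) r then 1 else 0) = 1 / real b"
    proof -
      have "expectation (\<lambda>\<omega>. if slot b (U \<omega>) r then 1 else 0) = expectation (?ind r)"
        by (rule Bochner_Integration.integral_cong[OF refl one])
      also have "\<dots> = measure P {\<omega> \<in> space P. slot b (U \<omega>) r}"
        using slot_ev[of r] by simp
      also have "\<dots> = 1 / real b" by (rule prob_slot[OF P rvU lawU r])
      finally show ?thesis .
    qed
    ultimately show ?thesis by simp
  qed
  have g_ind: "g (?YV \<omega>, ?WV \<omega>) = (\<Sum>r<b. ?ind r \<omega> * ?sc r \<omega>)" if "\<omega> \<in> space P" for \<omega>
    unfolding g_eq using if_ind[OF that] by (intro sum.cong refl) 
  have g_int: "integrable P (\<lambda>\<omega>. g (?YV \<omega>, ?WV \<omega>))"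
  proof (rule iffD2[OF Bochner_Integration.integrable_cong[OF refl g_ind]])
    show "integrable P (\<lambda>\<omega>. \<Sum>r<b. ?ind r \<omega> * ?sc r \<omega>)"
      using slot_term by (intro Bochner_Integration.integrable_sum) blast
  qed
  have f_int: "integrable P (\<lambda>\<omega>. f (?YV \<omega>, ?WV \<omega>))"
  proof (rule Bochner_Integration.integrable_bound[OF int])
    have "(\<lambda>\<omega>. (?YV \<omega>, ?WV \<omega>)) \<in> measurable P (?MY \<Otimes>\<^sub>M ?MW)"
      using indYW by (intro measurable_Pair) (simp_all add: indep_var_distribution_eq)
    then show "(\<lambda>\<omega>. f (?YV \<omega>, ?WV \<omega>)) \<in> borel_measurable P"
      using f_meas by (rule measurable_compose)
    show "AE \<omega> in P. norm (f (?YV \<omega>, ?WV \<omega>)) \<le> norm (run_max n Y \<omega>)"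
    proof (rule AE_I2)
      fix \<omega> assume w: "\<omega> \<in> space P"
      show "norm (f (?YV \<omega>, ?WV \<omega>)) \<le> norm (run_max n Y \<omega>)"
        unfolding f_eq run_max_def
        using stopped_value_bounds[OF n, of "\<lambda>i. Y i \<omega>" "accepts a b (\<lambda>k\<in>{1..K}. S k \<omega>) (U \<omega>)"] nn w
        by auto
    qed
  qed

  have "real a / real b * expectation (X m) - (real a / real b)\<^sup>2 * c
      = 1 / real b * (real a * expectation (X m) - real a * (real a / real b) * c)"
    using ab by (simp add: field_simps power2_eq_square)
  also have "\<dots> = (\<Sum>r<b. 1 / real b * expectation (?sc r))"
    unfolding sum_distrib_left[symmetric]
    using sum_expectation_score[OF indXb lawX mb, of a c] intX[of m] ab by simp
  also have "\<dots> = (\<Sum>r<b. expectation (\<lambda>\<omega>. ?ind r \<omega> * ?sc r \<omega>))"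
    using slot_term by simp
  also have "\<dots> = expectation (\<lambda>\<omega>. \<Sum>r<b. ?ind r \<omega> * ?sc r \<omega>)"
    using slot_term by (intro Bochner_Integration.integral_sum[symmetric]) auto
  also have "\<dots> = expectation (\<lambda>\<omega>. g (?YV \<omega>, ?WV \<omega>))"
    by (rule Bochner_Integration.integral_cong[OF refl g_ind[symmetric]])
  also have "\<dots> \<le> expectation (\<lambda>\<omega>. f (?YV \<omega>, ?WV \<omega>))"
  proof (rule indep_var_integral_mono[OF indYW g_meas f_meas g_int f_int])
    fix w
    show "expectation (\<lambda>\<omega>. g (?YV \<omega>, w)) \<le> expectation (\<lambda>\<omega>. f (?YV \<omega>, w))"
    proof (cases "\<exists>r. slot b (w 0) r")
      case True
      then obtain r where r: "slot b (w 0) r" ..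
      then have "r < b" by (simp add: slot_def)
      have "accepts a b (?T w) (w 0) = (\<lambda>y. r \<in> top_set a b (insert_at r (?T w) y))"
        using accepts_slot[OF r] by blast
      then show ?thesis
        unfolding f_def g_def fst_conv snd_conv sum_slot[OF r] max_YV sv_restr
        using stopped_value_ge_score[OF P n Y nn int ce ab(2) \<open>r < b\<close>, of "?T w"] by simp
    next
      case False
      then have ns: "\<And>r. \<not> slot b (w 0) r" by blast
      have "f (?YV \<omega>, w) = 0" for \<omega>
        unfolding f_def fst_conv snd_conv
        by (rule stopped_value_no_hit) (rule no_slot(1)[OF ns])
      moreover have "g (?YV \<omega>, w) = 0" for \<omega>
        unfolding g_def fst_conv snd_conv by (rule no_slot(2)[OF ns])
      ultimately show ?thesis by simp
    qed
  qed
  finally show ?thesis unfolding f_eq Xm .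
qed

lemma finite_frac_set: "finite (frac_set K)"
proof -
  have "frac_set K \<subseteq> (\<lambda>(a, b). real a / real b) ` ({..K+1} \<times> {..K+1})"
    unfolding frac_set_def by (force simp: image_iff)
  then show ?thesis by (rule finite_subset) simp
qed

lemma beta_const_attained:
  assumes "1 \<le> K"
  obtains a b where "0 < a" "a < b" "b \<le> K + 1"
    "beta_const C K = real a / real b - C * (real a / real b)\<^sup>2"
proof -
  have ne: "frac_set K \<noteq> {}"
  proof -
    have "real 1 / real 2 \<in> frac_set K"
      unfolding frac_set_def mem_Collect_eq using assms
      by (intro exI[of _ "1::nat"] exI[of _ "2::nat"]) simp
    then show ?thesis by blast
  qed
  let ?F = "(\<lambda>x. x - C * x\<^sup>2) ` frac_set K"
  have "beta_const C K = Max ?F"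
    unfolding beta_const_def using ne finite_frac_set by (intro cSup_eq_Max) auto
  moreover have "Max ?F \<in> ?F" using ne finite_frac_set by (intro Max_in) auto
  ultimately obtain x where "x \<in> frac_set K" "beta_const C K = x - C * x\<^sup>2" by auto
  then show thesis using that unfolding frac_set_def by blast
qed

theorem theorem4:
  fixes n K :: nat and C :: real
  assumes "1 \<le> n" and "1 \<le> K" and "0 \<le> C"
  shows "\<exists>d. stopping_rule n K d \<and>
    (\<forall>(P :: 'a measure) Y S U.
       prob_space P \<longrightarrow>
       (\<forall>i\<in>{1..n}. Y i \<in> borel_measurable P) \<longrightarrow>
       (\<forall>i\<in>{1..n}. \<forall>\<omega>\<in>space P. 0 \<le> Y i \<omega>) \<longrightarrow>
       integrable P (run_max n Y) \<longrightarrow>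
       (\<forall>i\<in>{1..n}. AE \<omega> in P.
          real_cond_exp P (gen_sigma P i Y) (\<lambda>\<omega>. MAX j\<in>{i..n}. Y j \<omega> - Y i \<omega>) \<omega>
            \<le> C * (\<integral>\<omega>. run_max n Y \<omega> \<partial>P)) \<longrightarrow>
       sample_access P n K Y S U \<longrightarrow>
       (\<integral>\<omega>. Y (the_enat (induced_time n K d S Y U \<omega>)) \<omega>
            * indicator {\<omega>. induced_time n K d S Y U \<omega> \<le> enat n} \<omega> \<partial>P)
         \<ge> beta_const C K * (\<integral>\<omega>. run_max n Y \<omega> \<partial>P))"
proof -
  obtain a b where ab: "0 < a" "a < b" "b \<le> K + 1"
    and beta: "beta_const C K = real a / real b - C * (real a / real b)\<^sup>2"
    using assms(2) by (rule beta_const_attained)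
  show ?thesis
  proof (intro exI[of _ "threshold_rule a b"] conjI allI impI)
    show "stopping_rule n K (threshold_rule a b)"
      using ab(3) by (rule stopping_rule_threshold_rule)
    fix P :: "'a measure" and Y S U
    assume P: "prob_space P" and Y: "\<forall>i\<in>{1..n}. Y i \<in> borel_measurable P"
      and nn: "\<forall>i\<in>{1..n}. \<forall>\<omega>\<in>space P. 0 \<le> Y i \<omega>"
      and int: "integrable P (run_max n Y)"
      and ce: "\<forall>i\<in>{1..n}. AE \<omega> in P.
          real_cond_exp P (gen_sigma P i Y) (\<lambda>\<omega>. MAX j\<in>{i..n}. Y j \<omega> - Y i \<omega>) \<omega>
            \<le> C * (\<integral>\<omega>. run_max n Y \<omega> \<partial>P)"
      and sa: "sample_access P n K Y S U"
    have "beta_const C K * (\<integral>\<omega>. run_max n Y \<omega> \<partial>P)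
        = real a / real b * (\<integral>\<omega>. run_max n Y \<omega> \<partial>P)
          - (real a / real b)\<^sup>2 * (C * (\<integral>\<omega>. run_max n Y \<omega> \<partial>P))"
      unfolding beta by (simp add: algebra_simps)
    also have "\<dots> \<le> (\<integral>\<omega>. stopped_value n (accepts a b (\<lambda>k\<in>{1..K}. S k \<omega>) (U \<omega>)) (\<lambda>i. Y i \<omega>) \<partial>P)"
      using Y nn ce by (intro threshold_rule_reward[OF P assms(1) _ _ int _ sa ab]) auto
    finally show "(\<integral>\<omega>. Y (the_enat (induced_time n K (threshold_rule a b) S Y U \<omega>)) \<omega>
            * indicator {\<omega>. induced_time n K (threshold_rule a b) S Y U \<omega> \<le> enat n} \<omega> \<partial>P)
         \<ge> beta_const C K * (\<integral>\<omega>. run_max n Y \<omega> \<partial>P)"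
      unfolding reward_eq_stopped_value .
  qed
qed

end
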